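(* Let $B>0$ and let $a:[0,\infty)\to\mathbb{C}$ be measurable and bounded, with $M=\sup_{t>0}|a(t)|$, so that the Laplace transform $$f(z)=\int_0^\infty a(t)e^{-zt}\,dt,\qquad z=x+iy,$$ is analytic for $x=\mathrm{Re}\,z>0$. Suppose that $f(x)$ tends to a (finite) limit, denoted $f(0)$, as $x\searrow 0$ (with $x$ real), and that the quotient $$q(x+iy)=\frac{f(x+iy)-f(x)}{iy},\qquad x>0,$$ converges in the distributional sense to a pseudofunction $q(iy)$ on the interval $\{-B<y<B\}$ as $x\searrow 0$. Then $$\limsup_{T\to\infty}\left|\int_0^T a(t)\,dt-f(0)\right|\le\frac{2M}{B}.$$
   Context: For fixed $x>0$, the function $y\mapsto q(x+iy)$ is taken at $y=0$ to have its limiting value $f'(x)$. Fourier transforms are normalized by $\hat\phi(t)=\int_{\mathbb{R}}\phi(y)e^{-iyt}\,dy$ for Schwartz functions $\phi$. A tempered distribution $F$ on $\mathbb{R}$ is called a pseudofunction (on $\mathbb{R}$) if it is the distributional Fourier transform of a (measurable, locally integrable) function $b$ on $\mathbb{R}$ with $b(t)\to0$ as $t\to\pm\infty$, i.e. $\langle F,\phi\rangle=\int_{\mathbb{R}}b(t)\hat\phi(t)\,dt$ for all Schwartz functions $\phi$. "$q(x+iy)$ converges in the distributional sense to a pseudofunction $q(iy)$ on $(-B,B)$ as $x\searrow0$" means that both of the following hold: (i) for every $C^\infty$ function $\phi$ with compact support in $(-B,B)$, the integral $\int_{\mathbb{R}}q(x+iy)\phi(y)\,dy$ tends to a limit $\langle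 q(iy),\phi(y)\rangle$ as $x\searrow 0$; (ii) $q(iy)$ is the restriction to $(-B,B)$ of a pseudofunction on $\mathbb{R}$, i.e. there is a pseudofunction $F$ on $\mathbb{R}$ with $\langle q(iy),\phi(y)\rangle=\langle F,\phi\rangle$ for every $C^\infty$ function $\phi$ with compact support in $(-B,B)$. *)

theory Defs
  imports "HOL-Analysis.Analysis"
begin

section \<open>Test functions and tempered distributions on the real line\<close>

definition nth_deriv :: "nat \<Rightarrow> (real \<Rightarrow> complex) \<Rightarrow> real \<Rightarrow> complex" where
  "nth_deriv n \<phi> = ((\<lambda>g t. vector_derivative g (at t)) ^^ n) \<phi>"

definition smooth :: "(real \<Rightarrow> complex) \<Rightarrow> bool" where
  "smooth \<phi> \<longleftrightarrow> (\<forall>n t. nth_deriv n \<phi> differentiable (at t))"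

definition test_function_on :: "real set \<Rightarrow> (real \<Rightarrow> complex) \<Rightarrow> bool" where
  "test_function_on U \<phi> \<longleftrightarrow>
     smooth \<phi> \<and> compact (closure {y. \<phi> y \<noteq> 0}) \<and> closure {y. \<phi> y \<noteq> 0} \<subseteq> U"

definition schwartz :: "(real \<Rightarrow> complex) \<Rightarrow> bool" where
  "schwartz \<phi> \<longleftrightarrow>
     smooth \<phi> \<and> (\<forall>m n. bounded (range (\<lambda>t. t ^ m *\<^sub>R nth_deriv n \<phi> t)))"

text \<open>The supremum is meaningful only where it is finite, in particular for Schwartz functions.\<close>
definition schwartz_seminorm :: "nat \<Rightarrow> nat \<Rightarrow> (real \<Rightarrow> complex) \<Rightarrow> real" where
  "schwartz_seminorm m n \<phi> = (SUP t. cmod (t ^ m *\<^sub>R nth_deriv n \<phi> t))"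

text \<open>
  Functionals are total HOL functions of which only the values on Schwartz functions matter.
  The Schwartz space is metrizable, so continuity may be stated with sequences.
\<close>
definition tempered_distribution :: "((real \<Rightarrow> complex) \<Rightarrow> complex) \<Rightarrow> bool" where
  "tempered_distribution F \<longleftrightarrow>
     (\<forall>\<phi> \<psi>. schwartz \<phi> \<longrightarrow> schwartz \<psi> \<longrightarrow> F (\<lambda>t. \<phi> t + \<psi> t) = F \<phi> + F \<psi>) \<and>
     (\<forall>c \<phi>. schwartz \<phi> \<longrightarrow> F (\<lambda>t. c * \<phi> t) = c * F \<phi>) \<and>
     (\<forall>\<Phi> \<phi>. (\<forall>k. schwartz (\<Phi> k)) \<longrightarrow> schwartz \<phi> \<longrightarrow>
        (\<forall>m n. (\<lambda>k. schwartz_seminorm m n (\<lambda>t. \<Phi> k t - \<phi> t)) \<longlonglongrightarrow> 0) \<longrightarrow>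
        (\<lambda>k. F (\<Phi> k)) \<longlonglongrightarrow> F \<phi>)"


section \<open>Pseudofunctions\<close>

definition fourier :: "(real \<Rightarrow> complex) \<Rightarrow> real \<Rightarrow> complex" where
  "fourier \<phi> t = (LINT y|lebesgue. \<phi> y * exp (- \<i> * of_real y * of_real t))"

definition locally_integrable :: "(real \<Rightarrow> complex) \<Rightarrow> bool" where
  "locally_integrable b \<longleftrightarrow> (\<forall>K. compact K \<longrightarrow> set_integrable lebesgue K b)"

definition pseudofunction :: "((real \<Rightarrow> complex) \<Rightarrow> complex) \<Rightarrow> bool" where
  "pseudofunction F \<longleftrightarrow>
     tempered_distribution F \<and>
     (\<exists>b. b \<in> borel_measurable lebesgue \<and> locally_integrable b \<and>
          (b \<longlongrightarrow> 0) at_top \<and> (b \<longlongrightarrow> 0) at_bot \<and>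
          (\<forall>\<phi>. schwartz \<phi> \<longrightarrow> F \<phi> = (LINT t|lebesgue. b t * fourier \<phi> t)))"

text \<open>The functional \<open>Q\<close> is the distributional boundary value of \<open>q\<close> on \<open>U\<close>.\<close>
definition converges_to_pseudofunction_on :: "(complex \<Rightarrow> complex) \<Rightarrow> real set \<Rightarrow> bool" where
  "converges_to_pseudofunction_on q U \<longleftrightarrow>
     (\<exists>Q. (\<forall>\<phi>. test_function_on U \<phi> \<longrightarrow>
              ((\<lambda>x. LINT y|lebesgue. q (Complex x y) * \<phi> y) \<longlongrightarrow> Q \<phi>) (at_right 0)) \<and>
          (\<exists>F. pseudofunction F \<and> (\<forall>\<phi>. test_function_on U \<phi> \<longrightarrow> Q \<phi> = F \<phi>)))"


section \<open>Laplace transform and difference quotient\<close>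

definition laplace :: "(real \<Rightarrow> complex) \<Rightarrow> complex \<Rightarrow> complex" where
  "laplace a z = (LINT t:{0..}|lebesgue. a t * exp (- z * of_real t))"

text \<open>On the real axis the quotient is given its limiting value, the complex derivative.\<close>
definition vertical_quotient :: "(complex \<Rightarrow> complex) \<Rightarrow> complex \<Rightarrow> complex" where
  "vertical_quotient f z =
     (if Im z = 0 then deriv f z
      else (f z - f (of_real (Re z))) / (\<i> * of_real (Im z)))"

end

theory Submission
  imports Defs "HOL-Probability.Sinc_Integral"
begin

text \<open>
  For \<open>x > 0\<close> the quotient \<open>q(x + \<i>y)\<close> is the Fourier transform of
  \<open>\<sigma>\<^sub>x(t) = \<integral>\<^sub>0\<^sup>t a(u) e\<^sup>-\<^sup>x\<^sup>u du - f(x)\<close> (\<open>t > 0\<close>). These functions are bounded by \<open>C + M t\<close>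
  uniformly in small \<open>x\<close>, so pairing \<open>q\<close> with \<open>\<phi>(y) e\<^sup>\<i>\<^sup>T\<^sup>y\<close> and letting first \<open>x \<rightarrow> 0\<close>, then
  \<open>T \<rightarrow> \<infinity>\<close> shows that the convolution of \<open>s(t) = \<integral>\<^sub>0\<^sup>t a - f(0)\<close> with the Fourier transform of any
  test function on \<open>(-B, B)\<close> tends to \<open>0\<close>. As \<open>s\<close> is \<open>M\<close>-Lipschitz, it is bounded, and the
  convergence to \<open>0\<close> extends to the Fourier transform of \<open>1 - y\<^sup>2/R\<^sup>2\<close> on \<open>[-R, R]\<close> for \<open>R < B\<close>,
  which is a limit in \<open>L\<^sup>1\<close> of transforms of test functions. This is Newman's kernel: shifting its
  defining integral to a semicircle shows that the convolution differs from \<open>s\<close> by at most \<open>2M/R\<close>.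
\<close>

section \<open>Smooth functions\<close>

text \<open>A priori \<open>s\<close> is only known to grow at most linearly, while the transform of
  the parabola decays like \<open>1/u^2\<close>. So L^1 closeness of two kernels says nothing about
  their convolutions with \<open>s\<close> until \<open>s\<close> is known to be bounded.
  Boundedness comes from one test function whose transform decays rapidly and has nonzero integral:
  there \<open>s(t)\<close> may be replaced by \<open>s(T)\<close> at a cost bounded uniformly in T.
  The parabola itself has corners at the ends of its support; mollifying it multiplies its transform
  by that of a narrow bump of mass one. As for the constant, \<open>1 + z^2\<close> contributes a
  factor \<open>cos \<theta>\<close> on the unit semicircle, and this cancels the
  \<open>1 / cos \<theta>\<close> in the bound for z times the Laplace integral of a Lipschitz
  function. What remains for each half-line is the Lipschitz constant \<open>M/R\<close> left after
  scaling by R, hence \<open>2M/R\<close>, and R tends to B.\<close>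

lemma smooth_coinduct:
  assumes "P \<phi>"
    and step: "\<And>\<psi>. P \<psi> \<Longrightarrow> \<exists>\<psi>'. P \<psi>' \<and> (\<forall>t. (\<psi> has_vector_derivative \<psi>' t) (at t))"
  shows "smooth \<phi>"
proof -
  \<comment> \<open>Iterated derivatives are never computed: a class closed under differentiation
    contains all of them, because \<open>vector_derivative\<close> returns the unique
    derivative.\<close>
  have P: "P (nth_deriv n \<phi>)" for n
  proof (induction n)
    case 0
    then show ?case using \<open>P \<phi>\<close> by (simp add: nth_deriv_def)
  next
    case (Suc n)
    obtain \<psi>' where "P \<psi>'" "\<forall>t. (nth_deriv n \<phi> has_vector_derivative \<psi>' t) (at t)"
      using step[OF Suc] by blast
    then have "nth_deriv (Suc n) \<phi> = \<psi>'"
      by (auto simp: nth_deriv_def vector_derivative_at)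
    with \<open>P \<psi>'\<close> show ?case by simp
  qed
  show ?thesis
    unfolding smooth_def using step[OF P] by (metis differentiableI_vector)
qed

lemma smooth_vector_derivative:
  assumes "smooth \<phi>"
  shows "smooth (\<lambda>t. vector_derivative \<phi> (at t))"
    and "(\<phi> has_vector_derivative vector_derivative \<phi> (at t)) (at t)"
proof -
  have "nth_deriv n (\<lambda>t. vector_derivative \<phi> (at t)) = nth_deriv (Suc n) \<phi>" for n
    unfolding nth_deriv_def by (simp only: funpow_Suc_right o_apply)
  then show "smooth (\<lambda>t. vector_derivative \<phi> (at t))"
    using assms unfolding smooth_def by metis
  have "\<phi> differentiable (at t)"
    using assms unfolding smooth_def nth_deriv_def by (metis funpow_0)
  then show "(\<phi> has_vector_derivative vector_derivative \<phi> (at t)) (at t)"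
    by (simp add: vector_derivative_works)
qed

lemma smooth_nth_deriv: "smooth \<phi> \<Longrightarrow> smooth (nth_deriv n \<phi>)"
proof (induction n)
  case (Suc n)
  then show ?case
    using smooth_vector_derivative(1)[of "nth_deriv n \<phi>"] by (simp add: nth_deriv_def)
qed (simp add: nth_deriv_def)

lemma smooth_continuous: "smooth \<phi> \<Longrightarrow> continuous_on S \<phi>"
  by (meson continuous_at_imp_continuous_on has_vector_derivative_continuous smooth_vector_derivative(2))

lemma smooth_measurable [measurable_dest]: "smooth \<phi> \<Longrightarrow> \<phi> \<in> borel_measurable borel"
  by (simp add: borel_measurable_continuous_onI smooth_continuous)

text \<open>Products alone are not closed under differentiation, but finite sums of products are.
  This is the class fed to \<open>smooth_coinduct\<close>, in place of Leibniz's formula for higher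
  derivatives.\<close>

inductive product_sum :: "(real \<Rightarrow> complex) \<Rightarrow> bool" where
  prod: "smooth f \<Longrightarrow> smooth g \<Longrightarrow> product_sum (\<lambda>t. f t * g t)"
| add: "product_sum f \<Longrightarrow> product_sum g \<Longrightarrow> product_sum (\<lambda>t. f t + g t)"

lemma product_sum_derivative:
  assumes "product_sum \<phi>"
  shows "\<exists>\<psi>. product_sum \<psi> \<and> (\<forall>t. (\<phi> has_vector_derivative \<psi> t) (at t))"
  using assms
proof induction
  case (prod f g)
  let ?d = "\<lambda>h t. vector_derivative h (at t)"
  have "product_sum (\<lambda>t. f t * ?d g t + ?d f t * g t)"
    by (intro product_sum.intros prod smooth_vector_derivative)
  moreover have "((\<lambda>t. f t * g t) has_vector_derivative f t * ?d g t + ?d f t * g t) (at t)" for t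
    by (intro has_vector_derivative_mult smooth_vector_derivative prod)
  ultimately show ?case
    by (intro exI[of _ "\<lambda>t. f t * ?d g t + ?d f t * g t"]) auto
next
  case (add f g)
  then obtain f' g' where "product_sum f'" "\<forall>t. (f has_vector_derivative f' t) (at t)"
    "product_sum g'" "\<forall>t. (g has_vector_derivative g' t) (at t)" by blast
  then show ?case
    by (intro exI[of _ "\<lambda>t. f' t + g' t"]) (auto intro: product_sum.add has_vector_derivative_add)
qed

lemma smooth_mult: "smooth f \<Longrightarrow> smooth g \<Longrightarrow> smooth (\<lambda>t. f t * g t)"
  by (rule smooth_coinduct[where P = product_sum]) (auto intro: product_sum.prod product_sum_derivative)

lemma smooth_exp: "smooth (\<lambda>t. exp (c * of_real t))"
proof (rule smooth_coinduct[where P = "\<lambda>\<psi>. \<exists>k. \<psi> = (\<lambda>t. k * exp (c * of_real t))"])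
  show "\<exists>k. (\<lambda>t. exp (c * of_real t)) = (\<lambda>t. k * exp (c * of_real t))"
    by (rule exI[of _ 1]) simp
next
  fix \<psi> :: "real \<Rightarrow> complex" assume "\<exists>k. \<psi> = (\<lambda>t. k * exp (c * of_real t))"
  then obtain k where k: "\<psi> = (\<lambda>t. k * exp (c * of_real t))" by blast
  have "((\<lambda>z. k * exp (c * z)) has_field_derivative k * c * exp (c * of_real t)) (at (of_real t))" for t
    by (auto intro!: derivative_eq_intros)
  then have "(\<psi> has_vector_derivative k * c * exp (c * of_real t)) (at t)" for t
    unfolding k by (rule has_vector_derivative_real_field)
  then show "\<exists>\<psi>'. (\<exists>k. \<psi>' = (\<lambda>t. k * exp (c * of_real t))) \<and>
      (\<forall>t. (\<psi> has_vector_derivative \<psi>' t) (at t))"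
    by (intro exI[of _ "\<lambda>t. k * c * exp (c * of_real t)"]) auto
qed

lemma smooth_const: "smooth (\<lambda>t. c)"
  by (rule smooth_coinduct[where P = "\<lambda>\<psi>. \<exists>c. \<psi> = (\<lambda>t. c)"])
    (auto intro!: exI[of _ "\<lambda>_. 0"] has_vector_derivative_const)

lemma smooth_affine:
  assumes "smooth \<phi>"
  shows "smooth (\<lambda>t. \<phi> (c * t + d))"
\<comment> \<open>The chain rule brings out a factor \<open>c\<close> at each differentiation; the
  scalar \<open>k\<close> in the class absorbs these factors.\<close>
proof (rule smooth_coinduct[where P = "\<lambda>\<psi>. \<exists>k \<phi>. smooth \<phi> \<and> \<psi> = (\<lambda>t. k *\<^sub>R \<phi> (c * t + d))"])
  show "\<exists>k \<phi>'. smooth \<phi>' \<and> (\<lambda>t. \<phi> (c * t + d)) = (\<lambda>t. k *\<^sub>R \<phi>' (c * t + d))"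
    using assms by (intro exI[of _ 1] exI[of _ \<phi>]) auto
next
  fix \<psi> :: "real \<Rightarrow> complex" assume "\<exists>k \<phi>. smooth \<phi> \<and> \<psi> = (\<lambda>t. k *\<^sub>R \<phi> (c * t + d))"
  then obtain k \<phi> where \<phi>: "smooth \<phi>" and \<psi>: "\<psi> = (\<lambda>t. k *\<^sub>R \<phi> (c * t + d))" by blast
  let ?d = "\<lambda>t. vector_derivative \<phi> (at t)"
  have "((\<lambda>t. c * t + d) has_vector_derivative c) (at t)" for t
    by (auto intro!: derivative_eq_intros)
  from vector_diff_chain_at[OF this smooth_vector_derivative(2)[OF \<phi>]]
  have "(\<psi> has_vector_derivative (k * c) *\<^sub>R ?d (c * t + d)) (at t)" for t
    unfolding \<psi> scaleR_scaleR[symmetric] o_def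
    by (rule bounded_linear.has_vector_derivative[OF bounded_linear_scaleR_right])
  then show "\<exists>\<psi>'. (\<exists>k \<phi>. smooth \<phi> \<and> \<psi>' = (\<lambda>t. k *\<^sub>R \<phi> (c * t + d))) \<and>
      (\<forall>t. (\<psi> has_vector_derivative \<psi>' t) (at t))"
    using smooth_vector_derivative(1)[OF \<phi>]
    by (intro exI[of _ "\<lambda>t. (k * c) *\<^sub>R ?d (c * t + d)"] conjI exI[of _ "k * c"] exI[of _ ?d]) auto
qed

section \<open>A smooth bump of mass one\<close>

definition flat :: "real poly \<Rightarrow> real \<Rightarrow> real" where
  "flat p x = (if 0 < x then poly p (inverse x) * exp (- inverse x) else 0)"

lemma poly_exp_decay: "((\<lambda>u. poly p u * exp (- u)) \<longlongrightarrow> (0::real)) at_top"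
proof -
  have "((\<lambda>u. u ^ n * exp (- u)) \<longlongrightarrow> (0::real)) at_top" for n
    using tendsto_power_div_exp_0[of n] by (simp add: exp_minus divide_inverse)
  then have "((\<lambda>u. coeff p n * (u ^ n * exp (- u))) \<longlongrightarrow> 0) at_top" for n
    by (rule tendsto_mult_right_zero)
  then have "((\<lambda>u. \<Sum>i\<le>degree p. coeff p i * (u ^ i * exp (- u))) \<longlongrightarrow> 0) at_top"
    by (rule tendsto_null_sum)
  then show ?thesis
    by (simp add: poly_altdef sum_distrib_right mult.assoc)
qed

lemma flat_tendsto_zero: "((\<lambda>x. flat p x) \<longlongrightarrow> 0) (at 0)"
proof -
  have "((\<lambda>x. poly p (inverse x) * exp (- inverse x)) \<longlongrightarrow> 0) (at_right (0::real))"
    by (rule filterlim_compose[OF poly_exp_decay filterlim_inverse_at_top_right])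
  then have "(flat p \<longlongrightarrow> 0) (at_right 0)"
    by (rule Lim_transform_eventually)
      (auto simp: eventually_at_filter flat_def intro: always_eventually)
  moreover have "(flat p \<longlongrightarrow> 0) (at_left 0)"
    by (rule Lim_transform_eventually[OF tendsto_const])
      (auto simp: eventually_at_filter flat_def intro: always_eventually)
  ultimately show ?thesis
    by (simp add: filterlim_split_at)
qed

text \<open>All derivatives of \<open>exp (-1/x)\<close>, extended by zero, are a polynomial in 1/x
  times that function, hence the polynomial parameter of \<open>flat\<close>. With u = 1/x,
  differentiation sends \<open>p(u) exp(-u)\<close> to \<open>u^2 (p(u) - p'(u)) exp(-u)\<close>,
  and \<open>[:0, 0, 1:]\<close> is \<open>u^2\<close>.\<close>

lemma flat_has_derivative:
  "(flat p has_real_derivative flat ((p - pderiv p) * [:0, 0, 1:]) x) (at x)"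
proof -
  let ?p' = "(p - pderiv p) * [:0, 0, 1:]"
  consider "x < 0" | "x = 0" | "x > 0" by linarith
  then show ?thesis
  proof cases
    case 1
    have "((\<lambda>_. 0) has_real_derivative 0) (at x)" by simp
    then have "(flat p has_real_derivative 0) (at x)"
      using 1 by (rule_tac has_field_derivative_transform_within_open[where S = "{..<0}"])
        (auto simp: flat_def)
    then show ?thesis using 1 by (simp add: flat_def)
  next
    case 2
    \<comment> \<open>The difference quotient at 0 is \<open>flat p h / h\<close>, and dividing by h
      multiplies the polynomial by u = 1/h.\<close>
    have "((\<lambda>h. flat (p * [:0, 1:]) h) \<longlongrightarrow> 0) (at 0)" by (rule flat_tendsto_zero)
    then have "((\<lambda>h. (flat p (0 + h) - flat p 0) / h) \<longlongrightarrow> 0) (at 0)"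
      by (rule Lim_transform_eventually)
        (auto simp: eventually_at_filter flat_def field_simps intro!: always_eventually)
    then show ?thesis
      using 2 by (simp add: DERIV_def flat_def)
  next
    case 3
    have "((\<lambda>x. poly p (inverse x) * exp (- inverse x)) has_real_derivative
        poly ?p' (inverse x) * exp (- inverse x)) (at x)"
      using 3 by (auto intro!: derivative_eq_intros simp: field_simps power2_eq_square)
    then have "((\<lambda>x. poly p (inverse x) * exp (- inverse x)) has_real_derivative flat ?p' x) (at x)"
      using 3 by (simp add: flat_def)
    then show ?thesis
      using 3 by (rule_tac has_field_derivative_transform_within_open[where S = "{0<..}"])
        (auto simp: flat_def)
  qed
qed

lemma smooth_flat: "smooth (\<lambda>x. of_real (flat p x))"
proof (rule smooth_coinduct[where P = "\<lambda>\<psi>. \<exists>p. \<psi> = (\<lambda>x. of_real (flat p x))"])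
  fix \<psi> :: "real \<Rightarrow> complex" assume "\<exists>p. \<psi> = (\<lambda>x. of_real (flat p x))"
  then obtain p where p: "\<psi> = (\<lambda>x. of_real (flat p x))" by blast
  have "(\<psi> has_vector_derivative of_real (flat ((p - pderiv p) * [:0, 0, 1:]) t)) (at t)" for t
    unfolding p by (intro has_vector_derivative_of_real)
      (simp only: flat_has_derivative flip: has_real_derivative_iff_has_vector_derivative)
  then show "\<exists>\<psi>'. (\<exists>p. \<psi>' = (\<lambda>x. of_real (flat p x))) \<and> (\<forall>t. (\<psi> has_vector_derivative \<psi>' t) (at t))"
    by (intro exI[of _ "\<lambda>t. of_real (flat ((p - pderiv p) * [:0, 0, 1:]) t)"]) auto
qed blast

lemma exists_bump:
  assumes "\<epsilon> > 0"
  obtains \<psi> :: "real \<Rightarrow> real"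
  where "smooth (\<lambda>y. of_real (\<psi> y))" "\<And>y. \<psi> y \<ge> 0" "\<And>y. \<bar>y\<bar> > \<epsilon> \<Longrightarrow> \<psi> y = 0"
    "integrable lborel \<psi>" "(LINT y|lborel. \<psi> y) = 1"
proof -
  \<comment> \<open>The two factors are positive exactly for y > -\<epsilon> and for y < \<epsilon>;
    the shapes \<open>1 * y\<close> and \<open>- 1 * y\<close> are those of
    \<open>smooth_affine\<close>.\<close>
  define h where "h = (\<lambda>y. flat 1 (1 * y + \<epsilon>) * flat 1 (- 1 * y + \<epsilon>))"
  have sm: "smooth (\<lambda>y. of_real (h y))"
    using smooth_mult[OF smooth_affine[OF smooth_flat] smooth_affine[OF smooth_flat], of 1 1 \<epsilon> 1 "-1" \<epsilon>]
    by (simp add: h_def)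
  have nonneg: "h y \<ge> 0" for y by (auto simp: h_def flat_def)
  have zero: "h y = 0" if "\<bar>y\<bar> > \<epsilon>" for y using that by (auto simp: h_def flat_def)
  have "continuous_on UNIV (\<lambda>y. Re (of_real (h y)))"
    by (intro continuous_on_Re smooth_continuous sm)
  then have cont: "continuous_on UNIV h" by simp
  then have [measurable]: "h \<in> borel_measurable borel" by (rule borel_measurable_continuous_onI)
  have "set_integrable lborel {-\<epsilon>..\<epsilon>} h"
    unfolding set_integrable_def
    by (rule borel_integrable_compact) (auto intro: continuous_on_subset[OF cont])
  then have int: "integrable lborel h"
    unfolding set_integrable_def
    by (rule Bochner_Integration.integrable_bound)
      (auto simp: indicator_def zero intro!: AE_I2 zero)
  \<comment> \<open>A vanishing integral would make the nonnegative \<open>h\<close> zero almost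
    everywhere, but it is positive on an interval of positive length.\<close>
  have pos: "(LINT y|lborel. h y) \<noteq> 0"
  proof
    assume "(LINT y|lborel. h y) = 0"
    then have "AE y in lborel. h y = 0"
      using integral_nonneg_eq_0_iff_AE[OF int] nonneg by auto
    then have "emeasure lborel {y \<in> space lborel. h y \<noteq> 0} = 0"
      by (subst (asm) AE_iff_measurable[OF _ refl]) auto
    moreover have "{-\<epsilon><..<\<epsilon>} \<subseteq> {y \<in> space lborel. h y \<noteq> 0}"
      by (auto simp: h_def flat_def)
    then have "emeasure lborel {-\<epsilon><..<\<epsilon>} \<le> emeasure lborel {y \<in> space lborel. h y \<noteq> 0}"
      by (rule emeasure_mono) measurable
    ultimately have "emeasure lborel {-\<epsilon><..<\<epsilon>} = 0" by simp
    then show False using assms by simp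
  qed
  define c where "c = inverse (LINT y|lborel. h y)"
  have c: "c \<ge> 0" unfolding c_def using nonneg by (simp add: integral_nonneg_AE)
  show ?thesis
  proof
    show "smooth (\<lambda>y. of_real (c * h y))"
      using smooth_mult[OF smooth_const sm, of "of_real c"] by simp
    show "c * h y \<ge> 0" for y using c nonneg by simp
    show "c * h y = 0" if "\<bar>y\<bar> > \<epsilon>" for y using zero that by simp
    show "integrable lborel (\<lambda>y. c * h y)" using int by simp
    show "(LINT y|lborel. c * h y) = 1" using pos int by (simp add: c_def)
  qed
qed

text \<open>Differentiation under the integral moves the derivative onto \<open>\<psi>\<close> and
  leaves \<open>P\<close> alone, so for fixed \<open>P\<close> and \<open>R\<close> these integrals
  form a class closed under differentiation.\<close>

lemma smooth_convolution:
  assumes "smooth \<psi>" and P: "continuous_on {-1..1} P"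
  shows "smooth (\<lambda>y. integral {-1..1::real} (\<lambda>v. P v * \<psi> (y - R * v)))"
proof (rule smooth_coinduct[where P = "\<lambda>\<phi>. \<exists>\<psi>. smooth \<psi> \<and>
    \<phi> = (\<lambda>y. integral {-1..1::real} (\<lambda>v. P v * \<psi> (y - R * v)))"])
  show "\<exists>\<psi>'. smooth \<psi>' \<and> (\<lambda>y. integral {-1..1::real} (\<lambda>v. P v * \<psi> (y - R * v))) =
      (\<lambda>y. integral {-1..1::real} (\<lambda>v. P v * \<psi>' (y - R * v)))"
    using assms by blast
next
  fix \<phi> :: "real \<Rightarrow> complex"
  assume "\<exists>\<psi>. smooth \<psi> \<and> \<phi> = (\<lambda>y. integral {-1..1::real} (\<lambda>v. P v * \<psi> (y - R * v)))"
  then obtain \<psi> where \<psi>: "smooth \<psi>"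
    and \<phi>: "\<phi> = (\<lambda>y. integral {-1..1::real} (\<lambda>v. P v * \<psi> (y - R * v)))" by blast
  define d where "d = (\<lambda>t. vector_derivative \<psi> (at t))"
  have d: "smooth d" "\<And>t. (\<psi> has_vector_derivative d t) (at t)"
    unfolding d_def using smooth_vector_derivative[OF \<psi>] by auto
  have "(\<phi> has_vector_derivative integral {-1..1::real} (\<lambda>v. P v * d (y - R * v))) (at y)" for y
    unfolding \<phi> cbox_interval[symmetric]
  proof (rule leibniz_rule_vector_derivative[where U = UNIV])
    fix y t :: real
    have "((\<lambda>y. 1 * y + (- R * t)) has_vector_derivative 1) (at y)"
      by (auto intro!: derivative_eq_intros)
    from vector_diff_chain_at[OF this d(2)]
    have "((\<lambda>y. \<psi> (y - R * t)) has_vector_derivative d (y - R * t)) (at y)"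
      by (simp add: o_def)
    then show "((\<lambda>y. P t * \<psi> (y - R * t)) has_vector_derivative P t * d (y - R * t)) (at y)"
      by (rule has_vector_derivative_mult_right)
  next
    show "(\<lambda>v. P v * \<psi> (y - R * v)) integrable_on cbox (-1) 1" for y
      by (rule integrable_continuous)
        (auto intro!: continuous_intros P continuous_on_compose2[OF smooth_continuous[OF \<psi>, of UNIV]])
    show "continuous_on (UNIV \<times> cbox (-1) 1) (\<lambda>(y, v). P v * d (y - R * v))"
      unfolding split_beta
      by (auto intro!: continuous_intros continuous_on_compose2[OF P]
          continuous_on_compose2[OF smooth_continuous[OF d(1), of UNIV]])
  qed auto
  then show "\<exists>\<psi>'. (\<exists>\<psi>. smooth \<psi> \<and> \<psi>' = (\<lambda>y. integral {-1..1::real} (\<lambda>v. P v * \<psi> (y - R * v)))) \<and>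
      (\<forall>t. (\<phi> has_vector_derivative \<psi>' t) (at t))"
    using d(1) by blast
qed

section \<open>Test functions and their Fourier transforms\<close>

lemma test_function_onI:
  assumes "smooth \<phi>" "\<And>y. \<bar>y\<bar> > R \<Longrightarrow> \<phi> y = 0" "{-R..R} \<subseteq> U"
  shows "test_function_on U \<phi>"
proof -
  have "closure {y. \<phi> y \<noteq> 0} \<subseteq> {-R..R}"
  proof (rule closure_minimal)
    show "{y. \<phi> y \<noteq> 0} \<subseteq> {-R..R}" using assms(2) by (smt (verit) atLeastAtMost_iff mem_Collect_eq subsetI)
  qed simp
  then show ?thesis
    unfolding test_function_on_def using assms
    by (meson closed_closure compact_Icc compact_eq_bounded_closed bounded_subset order_trans)
qed

lemma nth_deriv_zero_outside:
  assumes "\<And>y. \<bar>y\<bar> > R \<Longrightarrow> \<phi> y = 0" "\<bar>y\<bar> > R"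
  shows "nth_deriv n \<phi> y = 0"
  using \<open>\<bar>y\<bar> > R\<close>
proof (induction n arbitrary: y)
  case 0
  then show ?case by (simp add: nth_deriv_def assms)
next
  case (Suc n)
  have "open {y::real. \<bar>y\<bar> > R}"
    by (intro open_Collect_less continuous_intros)
  from has_vector_derivative_const this have "(nth_deriv n \<phi> has_vector_derivative 0) (at y)"
    by (rule has_vector_derivative_transform_within_open) (simp_all add: Suc)
  then show ?case by (simp add: nth_deriv_def vector_derivative_at)
qed

lemma smooth_zero_outside_imp_schwartz:
  assumes "smooth \<phi>" "\<And>y. \<bar>y\<bar> > R \<Longrightarrow> \<phi> y = 0"
  shows "schwartz \<phi>"
  unfolding schwartz_def
proof (intro conjI allI assms)
  fix m n
  let ?g = "\<lambda>t. t ^ m *\<^sub>R nth_deriv n \<phi> t"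
  have "compact (?g ` {-R..R})"
    by (intro compact_continuous_image continuous_intros smooth_continuous smooth_nth_deriv assms) auto
  then have "bounded (insert 0 (?g ` {-R..R}))" by (simp add: compact_imp_bounded)
  moreover have "range ?g \<subseteq> insert 0 (?g ` {-R..R})"
  proof clarify
    fix t assume "?g t \<notin> ?g ` {-R..R}"
    then have "t \<notin> {-R..R}" by blast
    then have "\<bar>t\<bar> > R" by auto
    then show "?g t = 0" using nth_deriv_zero_outside[of R \<phi> t n] assms(2) by simp
  qed
  ultimately show "bounded (range ?g)" by (rule bounded_subset)
qed

lemma smooth_zero_outside_integrable:
  assumes "smooth \<phi>" "\<And>y. \<bar>y\<bar> > R \<Longrightarrow> \<phi> y = 0"
  shows "integrable lborel \<phi>"
proof -
  have "integrable lborel (\<lambda>x. indicator {-R..R} x *\<^sub>R \<phi> x)"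
    by (rule borel_integrable_compact) (auto intro!: smooth_continuous assms)
  moreover have "(\<lambda>x. indicator {-R..R} x *\<^sub>R \<phi> x) = \<phi>"
  proof
    show "indicator {-R..R} x *\<^sub>R \<phi> x = \<phi> x" for x
      using assms(2)[of x] by (auto simp: indicator_def)
  qed
  ultimately show ?thesis by simp
qed

text \<open>Common form of every interchange of integrals below. A pointwise majorant
  \<open>w\<close> whose inner integrals are at most an integrable \<open>W\<close> gives absolute
  integrability on the product, so only one-dimensional integrals have to be checked each
  time.\<close>

lemma Fubini_dominated:
  fixes f :: "real \<Rightarrow> real \<Rightarrow> complex"
  assumes meas: "(\<lambda>(x, y). f x y) \<in> borel_measurable (lborel \<Otimes>\<^sub>M lborel)"
    and w: "AE x in lborel. integrable lborel (w x) \<and> (LINT y|lborel. w x y) \<le> W x"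
    and bound: "\<And>x y. cmod (f x y) \<le> w x y"
    and W: "integrable lborel W"
  shows "(LINT x|lborel. LINT y|lborel. f x y) = (LINT y|lborel. LINT x|lborel. f x y)"
    and "integrable lborel (\<lambda>x. LINT y|lborel. f x y)"
    and "integrable lborel (\<lambda>y. LINT x|lborel. f x y)"
proof -
  have [measurable]: "f x \<in> borel_measurable borel" for x
    using measurable_compose[OF measurable_Pair1'[of x lborel lborel] meas] by simp
  have 1: "AE x in lborel. integrable lborel (f x)"
    using w
  proof eventually_elim
    case (elim x)
    show ?case
      by (rule Bochner_Integration.integrable_bound[OF conjunct1[OF elim]])
        (auto intro!: AE_I2 order_trans[OF bound])
  qed
  have "integrable lborel (\<lambda>x. LINT y|lborel. cmod (f x y))"
  proof (rule Bochner_Integration.integrable_bound[OF W])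
    show "(\<lambda>x. LINT y|lborel. cmod (f x y)) \<in> borel_measurable lborel"
      using meas by measurable
    show "AE x in lborel. norm (LINT y|lborel. cmod (f x y)) \<le> norm (W x)"
      using w 1
    proof eventually_elim
      case (elim x)
      have "(LINT y|lborel. cmod (f x y)) \<le> (LINT y|lborel. w x y)"
        using elim bound by (intro integral_mono) auto
      moreover have "0 \<le> (LINT y|lborel. cmod (f x y))" by simp
      ultimately show ?case using elim by (smt (verit) real_norm_def)
    qed
  qed
  then have int: "integrable (lborel \<Otimes>\<^sub>M lborel) (\<lambda>(x, y). f x y)"
    using 1 by (intro lborel_pair.Fubini_integrable[OF meas]) simp_all
  show "(LINT x|lborel. LINT y|lborel. f x y) = (LINT y|lborel. LINT x|lborel. f x y)"
    by (rule lborel_pair.Fubini_integral[OF int, symmetric])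
  show "integrable lborel (\<lambda>x. LINT y|lborel. f x y)"
    by (rule lborel_pair.integrable_fst[OF int])
  show "integrable lborel (\<lambda>y. LINT x|lborel. f x y)"
    by (rule lborel_pair.integrable_snd[OF int])
qed

section \<open>Decay of transforms of compactly supported smooth functions\<close>

lemma fourier_eq_lborel:
  assumes [measurable]: "\<phi> \<in> borel_measurable borel"
  shows "fourier \<phi> t = (LINT y|lborel. \<phi> y * exp (- \<i> * of_real y * of_real t))"
  unfolding fourier_def by (rule integral_completion) measurable

lemma fourier_measurable [measurable]:
  assumes [measurable]: "\<phi> \<in> borel_measurable borel"
  shows "fourier \<phi> \<in> borel_measurable borel"
proof -
  have "(\<lambda>t. LINT y|lborel. \<phi> y * exp (- \<i> * of_real y * of_real t)) \<in> borel_measurable borel"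
    by measurable
  then show ?thesis by (simp add: fourier_eq_lborel cong: measurable_cong)
qed

lemma norm_exp_ii [simp]: "cmod (exp (- (\<i> * of_real y * of_real t))) = 1"
  "cmod (exp (\<i> * of_real y * of_real t)) = 1"
  by (simp_all add: norm_exp_eq_Re)

lemma integrable_mult_exp_ii:
  fixes \<phi> :: "real \<Rightarrow> complex"
  assumes "integrable lborel \<phi>"
  shows "integrable lborel (\<lambda>y. \<phi> y * exp (- \<i> * of_real y * of_real t))"
  using borel_measurable_integrable[OF assms]
  by (intro Bochner_Integration.integrable_bound[OF assms]) (auto simp: norm_mult)

lemma cmod_fourier_le:
  assumes [measurable]: "integrable lborel \<phi>"
  shows "cmod (fourier \<phi> t) \<le> (LINT y|lborel. cmod (\<phi> y))"
proof -
  have [measurable]: "\<phi> \<in> borel_measurable borel"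
    using borel_measurable_integrable[OF assms] by simp
  have "cmod (fourier \<phi> t) \<le> (LINT y|lborel. cmod (\<phi> y * exp (- \<i> * of_real y * of_real t)))"
    unfolding fourier_eq_lborel[OF \<open>\<phi> \<in> borel_measurable borel\<close>] by (rule integral_norm_bound)
  then show ?thesis by (simp add: norm_mult)
qed

text \<open>Integration by parts: \<open>\<phi>\<close> times the exponential vanishes at both ends
  of an interval containing the support, so the integral of its derivative is zero.\<close>

lemma fourier_vector_derivative:
  assumes "smooth \<phi>" "\<And>y. \<bar>y\<bar> > R \<Longrightarrow> \<phi> y = 0"
  shows "fourier (\<lambda>y. vector_derivative \<phi> (at y)) t = \<i> * of_real t * fourier \<phi> t"
proof -
  define d where "d = (\<lambda>y. vector_derivative \<phi> (at y))"
  have sm: "smooth d" and deriv: "(\<phi> has_vector_derivative d y) (at y)" for y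
    unfolding d_def using smooth_vector_derivative[OF assms(1)] by auto
  have d0: "d y = 0" if "\<bar>y\<bar> > R" for y
    using nth_deriv_zero_outside[of R \<phi> y 1] assms(2) that by (simp add: d_def nth_deriv_def)
  let ?e = "\<lambda>y. exp (- \<i> * of_real y * of_real t)"
  \<comment> \<open>\<open>R\<close> may be negative; \<open>\<bar>R\<bar> + 1\<close> is
    nonnegative and strictly beyond the support, so the boundary terms vanish.\<close>
  define S where "S = \<bar>R\<bar> + 1"
  have S: "S \<ge> 0" "\<phi> S = 0" "\<phi> (-S) = 0" unfolding S_def using assms(2) by auto
  have e: "(?e has_vector_derivative - \<i> * of_real t * ?e y) (at y within A)" for y A
  proof -
    have "((\<lambda>z. exp (- \<i> * z * of_real t)) has_field_derivative - \<i> * of_real t * ?e y) (at (of_real y))"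
      by (auto intro!: derivative_eq_intros)
    then show ?thesis
      using has_vector_derivative_at_within has_vector_derivative_real_field by blast
  qed
  have "(LINT y|lborel. indicator {-S..S} y *\<^sub>R (\<phi> y * (- \<i> * of_real t * ?e y) + d y * ?e y))
      = \<phi> S * ?e S - \<phi> (-S) * ?e (-S)"
  proof (rule integral_FTC_Icc)
    show "((\<lambda>y. \<phi> y * ?e y) has_vector_derivative \<phi> y * (- \<i> * of_real t * ?e y) + d y * ?e y)
        (at y within {-S..S})" for y
      by (intro has_vector_derivative_mult e has_vector_derivative_at_within[OF deriv])
    show "continuous_on {-S..S} (\<lambda>y. \<phi> y * (- \<i> * of_real t * ?e y) + d y * ?e y)"
      by (intro continuous_intros smooth_continuous assms sm)
  qed (use S in auto)
  moreover have "indicator {-S..S} y *\<^sub>R (\<phi> y * (- \<i> * of_real t * ?e y) + d y * ?e y)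
      = (- \<i> * of_real t) * (\<phi> y * ?e y) + d y * ?e y" for y
    using assms(2)[of y] d0[of y] by (auto simp: indicator_def S_def)
  ultimately have "0 = (LINT y|lborel. (- \<i> * of_real t) * (\<phi> y * ?e y) + d y * ?e y)"
    using S by simp
  also have "\<dots> = (- \<i> * of_real t) * fourier \<phi> t + fourier d t"
    unfolding fourier_eq_lborel[OF smooth_measurable[OF assms(1)]] fourier_eq_lborel[OF smooth_measurable[OF sm]]
    using integrable_mult_exp_ii[OF smooth_zero_outside_integrable[OF assms]]
      integrable_mult_exp_ii[OF smooth_zero_outside_integrable[OF sm d0]]
    by (subst Bochner_Integration.integral_add) (simp_all only: integral_mult_right_zero integrable_mult_right)
  finally show ?thesis unfolding d_def by (simp add: algebra_simps)
qed

lemma fourier_nth_deriv: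
  assumes "smooth \<phi>" "\<And>y. \<bar>y\<bar> > R \<Longrightarrow> \<phi> y = 0"
  shows "fourier (nth_deriv n \<phi>) t = (\<i> * of_real t) ^ n * fourier \<phi> t"
proof (induction n)
  case (Suc n)
  have "nth_deriv (Suc n) \<phi> = (\<lambda>y. vector_derivative (nth_deriv n \<phi>) (at y))"
    by (simp add: nth_deriv_def)
  then show ?case
    using fourier_vector_derivative[OF smooth_nth_deriv[OF assms(1), of n] nth_deriv_zero_outside[OF assms(2)]] Suc
    by simp
qed (simp add: nth_deriv_def)

text \<open>Derivatives of order n up to three bound |t|^n times the transform, and
  \<open>(1 + t^2) (1 + |t|)\<close> is the sum of these four powers. The weight
  \<open>1 + |t|\<close> is there to absorb functions of linear growth, and
  \<open>inverse (1 + t^2)\<close> is integrable.\<close>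

lemma fourier_decay:
  assumes "smooth \<phi>" "\<And>y. \<bar>y\<bar> > R \<Longrightarrow> \<phi> y = 0"
  obtains C where "C \<ge> 0" "\<And>t. (1 + \<bar>t\<bar>) * cmod (fourier \<phi> t) \<le> C * inverse (1 + t\<^sup>2)"
proof -
  define c where "c n = (LINT y|lborel. cmod (nth_deriv n \<phi> y))" for n
  have c0: "c n \<ge> 0" for n unfolding c_def by simp
  have c: "\<bar>t\<bar> ^ n * cmod (fourier \<phi> t) \<le> c n" for n t
  proof -
    have "integrable lborel (nth_deriv n \<phi>)"
      by (rule smooth_zero_outside_integrable[OF smooth_nth_deriv[OF assms(1)] nth_deriv_zero_outside[OF assms(2)]])
    from cmod_fourier_le[OF this, of t] show ?thesis
      by (simp add: fourier_nth_deriv[OF assms] norm_mult norm_power c_def)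
  qed
  show ?thesis
  proof
    show "c 0 + c 1 + c 2 + c 3 \<ge> 0" using c0 by (simp add: add_nonneg_nonneg)
    fix t :: real
    have "(1 + t\<^sup>2) * ((1 + \<bar>t\<bar>) * cmod (fourier \<phi> t)) =
      (\<Sum>n\<in>{0,1,2,3}. \<bar>t\<bar> ^ n * cmod (fourier \<phi> t))"
      by (simp add: algebra_simps power2_eq_square power3_eq_cube)
    also have "\<dots> \<le> c 0 + c 1 + c 2 + c 3"
      using c[of t 0] c[of t 1] c[of t 2] c[of t 3] by simp
    finally have "(1 + t\<^sup>2) * ((1 + \<bar>t\<bar>) * cmod (fourier \<phi> t)) \<le> c 0 + c 1 + c 2 + c 3" .
    moreover have "1 + t\<^sup>2 > 0" by (simp add: add_pos_nonneg)
    ultimately show "(1 + \<bar>t\<bar>) * cmod (fourier \<phi> t) \<le> (c 0 + c 1 + c 2 + c 3) * inverse (1 + t\<^sup>2)"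
      by (simp add: field_simps)
  qed
qed

lemma integrable_inverse_one_plus_square: "integrable lborel (\<lambda>t::real. inverse (1 + t\<^sup>2))"
  using integrable_inverse_1_plus_square by (simp add: set_integrable_def einterval_eq)

lemma weighted_fourier_integrable:
  assumes "smooth \<phi>" "\<And>y. \<bar>y\<bar> > R \<Longrightarrow> \<phi> y = 0"
  shows "integrable lborel (\<lambda>t. (1 + \<bar>t\<bar>) * cmod (fourier \<phi> t))"
proof -
  obtain C where C: "C \<ge> 0" "\<And>t. (1 + \<bar>t\<bar>) * cmod (fourier \<phi> t) \<le> C * inverse (1 + t\<^sup>2)"
    using fourier_decay[OF assms] by blast
  note [measurable] = smooth_measurable[OF assms(1)]
  show ?thesis
  proof (rule Bochner_Integration.integrable_bound)
    show "integrable lborel (\<lambda>t. C * inverse (1 + t\<^sup>2))"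
      using integrable_inverse_one_plus_square by simp
    show "AE t in lborel. norm ((1 + \<bar>t\<bar>) * cmod (fourier \<phi> t)) \<le> norm (C * inverse (1 + t\<^sup>2))"
      using C by (auto simp: abs_mult)
  qed measurable
qed

lemma fourier_integrable:
  assumes "smooth \<phi>" "\<And>y. \<bar>y\<bar> > R \<Longrightarrow> \<phi> y = 0"
  shows "integrable lborel (fourier \<phi>)"
proof (rule Bochner_Integration.integrable_bound[OF weighted_fourier_integrable[OF assms]])
  show "fourier \<phi> \<in> borel_measurable lborel"
    using fourier_measurable[OF smooth_measurable[OF assms(1)]] by simp
  have "cmod (fourier \<phi> t) \<le> (1 + \<bar>t\<bar>) * cmod (fourier \<phi> t)" for t
    using mult_right_mono[of 1 "1 + \<bar>t\<bar>" "cmod (fourier \<phi> t)"] by simp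
  then show "AE t in lborel. norm (fourier \<phi> t) \<le> norm ((1 + \<bar>t\<bar>) * cmod (fourier \<phi> t))"
    by (simp add: abs_mult)
qed

lemma fourier_tendsto_zero:
  assumes "smooth \<phi>" "\<And>y. \<bar>y\<bar> > R \<Longrightarrow> \<phi> y = 0"
  shows "((\<lambda>T. fourier \<phi> (t - T)) \<longlongrightarrow> 0) at_top"
proof -
  obtain C where C: "C \<ge> 0" "\<And>t. (1 + \<bar>t\<bar>) * cmod (fourier \<phi> t) \<le> C * inverse (1 + t\<^sup>2)"
    using fourier_decay[OF assms] by blast
  have bound: "cmod (fourier \<phi> s) \<le> C * inverse (1 + \<bar>s\<bar>)" for s
  proof -
    have "C * inverse (1 + s\<^sup>2) \<le> C"
      using C(1) by (intro mult_left_le) (simp_all add: inverse_le_1_iff)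
    with C(2)[of s] show ?thesis by (simp add: field_simps)
  qed
  have "((\<lambda>T. C * inverse (1 + \<bar>t - T\<bar>)) \<longlongrightarrow> 0) at_top"
  proof (intro tendsto_mult_right_zero tendsto_inverse_0_at_top)
    have "filterlim (\<lambda>T. - t + T) at_top at_top"
      by (rule filterlim_tendsto_add_at_top[OF tendsto_const filterlim_ident])
    then show "filterlim (\<lambda>T. 1 + \<bar>t - T\<bar>) at_top at_top"
      by (rule filterlim_at_top_mono) (auto intro!: always_eventually)
  qed
  from always_eventually[OF allI, OF bound] this show ?thesis
    by (rule Lim_null_comparison)
qed

text \<open>Modulation does not change supports, so every translate of the transform of a test
  function is the transform of a test function on the same interval. This is how T enters the
  pairing with the pseudofunction.\<close>

lemma fourier_modulate:
  "fourier (\<lambda>y. \<phi> y * exp (\<i> * of_real T * of_real y)) t = fourier \<phi> (t - T)"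
proof -
  have "exp (\<i> * of_real T * of_real y) * exp (- \<i> * of_real y * of_real t)
      = exp (- \<i> * of_real y * of_real (t - T))" for y
    unfolding exp_add[symmetric] by (simp add: algebra_simps)
  then show ?thesis
    unfolding fourier_def mult.assoc[of "\<phi> _"] by simp
qed

text \<open>Convolution theorem for \<open>\<psi>\<close> and \<open>P\<close> stretched by
  \<open>R\<close>. The integral runs over v rather than R v, so no Jacobian appears, and the
  transform of \<open>P\<close> is evaluated at R t.\<close>

lemma fourier_convolution:
  assumes "smooth \<psi>" "\<And>y. \<bar>y\<bar> > r \<Longrightarrow> \<psi> y = 0" and P: "continuous_on {-1..1} P"
  shows "fourier (\<lambda>y. integral {-1..1::real} (\<lambda>v. P v * \<psi> (y - R * v))) t
    = (LINT v|lborel. indicator {-1..1} v *\<^sub>R (P v * exp (- \<i> * of_real (R * v) * of_real t))) * fourier \<psi> t"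
proof -
  note [measurable] = smooth_measurable[OF assms(1)]
  define Q where "Q v = indicator {-1..1} v *\<^sub>R P v" for v
  have Q: "integrable lborel Q"
    unfolding Q_def by (rule borel_integrable_compact) (auto intro: P)
  have [measurable]: "Q \<in> borel_measurable borel"
    using borel_measurable_integrable[OF Q] by simp
  have \<psi>: "integrable lborel \<psi>" by (rule smooth_zero_outside_integrable[OF assms(1,2)])
  let ?e = "\<lambda>y. exp (- \<i> * of_real y * of_real t)"
  have conv: "integral {-1..1} (\<lambda>v. P v * \<psi> (y - R * v)) = (LINT v|lborel. Q v * \<psi> (y - R * v))" for y
  proof -
    have "set_integrable lborel {-1..1} (\<lambda>v. P v * \<psi> (y - R * v))"
      unfolding set_integrable_def
      by (rule borel_integrable_compact)
        (auto intro!: continuous_intros P continuous_on_compose2[OF smooth_continuous[OF assms(1), of UNIV]])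
    from set_borel_integral_eq_integral(2)[OF this] show ?thesis
      by (simp add: set_lebesgue_integral_def Q_def)
  qed
  have shift: "integrable lborel (\<lambda>y. f (y - R * v))" "(LINT y|lborel. f (y - R * v)) = (LINT y|lborel. f y)"
    if "integrable lborel f" for f :: "real \<Rightarrow> 'a::{banach, second_countable_topology}" and v
    using lborel_integrable_real_affine[OF that, of 1 "- R * v"] lborel_integral_real_affine[of 1 f "- R * v"]
    by simp_all
  have "fourier (\<lambda>y. integral {-1..1} (\<lambda>v. P v * \<psi> (y - R * v))) t
      = (LINT y|lborel. LINT v|lborel. Q v * \<psi> (y - R * v) * ?e y)"
    unfolding conv by (subst fourier_eq_lborel) simp_all
  also have "\<dots> = (LINT v|lborel. LINT y|lborel. Q v * \<psi> (y - R * v) * ?e y)"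
  proof (rule Fubini_dominated(1)[symmetric, where w = "\<lambda>v y. cmod (Q v) * cmod (\<psi> (y - R * v))"
        and W = "\<lambda>v. cmod (Q v) * (LINT y|lborel. cmod (\<psi> y))"])
    show "AE v in lborel. integrable lborel (\<lambda>y. cmod (Q v) * cmod (\<psi> (y - R * v))) \<and>
        (LINT y|lborel. cmod (Q v) * cmod (\<psi> (y - R * v))) \<le> cmod (Q v) * (LINT y|lborel. cmod (\<psi> y))"
      using shift[OF integrable_norm[OF \<psi>]] by auto
    show "integrable lborel (\<lambda>v. cmod (Q v) * (LINT y|lborel. cmod (\<psi> y)))" using Q by simp
  qed (auto simp: norm_mult)
  also have "\<dots> = (LINT v|lborel. Q v * ?e (R * v) * fourier \<psi> t)"
  proof (intro Bochner_Integration.integral_cong refl)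
    fix v
    have e: "?e y = ?e (R * v) * ?e (y - R * v)" for y
      unfolding exp_add[symmetric] by (simp add: algebra_simps)
    have "Q v * \<psi> (y - R * v) * ?e y = Q v * ?e (R * v) * (\<psi> (y - R * v) * ?e (y - R * v))" for y
      unfolding e[of y] by (simp only: mult_ac)
    then have "(LINT y|lborel. Q v * \<psi> (y - R * v) * ?e y)
        = (LINT y|lborel. Q v * ?e (R * v) * (\<psi> (y - R * v) * ?e (y - R * v)))"
      by (rule Bochner_Integration.integral_cong[OF refl])
    also have "\<dots> = Q v * ?e (R * v) * (LINT y|lborel. \<psi> (y - R * v) * ?e (y - R * v))"
      by (rule integral_mult_right_zero)
    finally show "(LINT y|lborel. Q v * \<psi> (y - R * v) * ?e y) = Q v * ?e (R * v) * fourier \<psi> t"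
      using shift(2)[OF integrable_mult_exp_ii[OF \<psi>]] by (simp add: fourier_eq_lborel)
  qed
  also have "\<dots> = (LINT v|lborel. Q v * ?e (R * v)) * fourier \<psi> t"
    by (rule integral_mult_left_zero)
  finally show ?thesis
    by (simp add: Q_def)
qed

section \<open>The Fourier transform of the truncated parabola\<close>

text \<open>The division by \<open>2 * pi\<close> normalizes the integral to 1, as Fourier inversion
  at y = 0 predicts; \<open>integral_kern\<close> proves this through the semicircle.\<close>

definition kern :: "real \<Rightarrow> complex" where
  "kern u = (LINT y|lborel. indicator {-1..1} y *\<^sub>R
     ((1 - of_real (y\<^sup>2)) * exp (- \<i> * of_real y * of_real u))) / of_real (2 * pi)"

lemma kern_measurable [measurable]: "kern \<in> borel_measurable borel"
  unfolding kern_def by measurable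

lemma kern_minus: "kern (- u) = kern u"
  unfolding kern_def
  by (subst lborel_integral_real_affine[of "-1" _ 0]) (simp_all add: indicator_def conj_commute)

text \<open>With z = \<open>cis \<theta>\<close> this is \<open>(1 + z^2) exp(-u z) dz\<close> with
  the factor 2 i left out. Against the \<open>2 * pi\<close> in \<open>kern\<close> and the i from
  dz on the segment, this leaves the division by \<open>pi\<close> in
  \<open>kern_eq_arc\<close>.\<close>

definition arc :: "real \<Rightarrow> real \<Rightarrow> complex" where
  "arc u \<theta> = indicator {-(pi/2)..pi/2} \<theta> *\<^sub>R
     (of_real (cos \<theta>) * (cis \<theta>)\<^sup>2 * exp (- of_real u * cis \<theta>))"

lemma cis_measurable [measurable]: "cis \<in> borel_measurable borel"
  by (intro borel_measurable_continuous_onI continuous_on_cis continuous_on_id)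

lemma cos_nonneg_half_pi: "\<theta> \<in> {-(pi/2)..pi/2} \<Longrightarrow> cos \<theta> \<ge> 0"
  by (auto intro: cos_ge_zero)

lemma cmod_arc: "cmod (arc u \<theta>) = indicator {-(pi/2)..pi/2} \<theta> * (cos \<theta> * exp (- (u * cos \<theta>)))"
  using cos_nonneg_half_pi[of \<theta>]
  by (auto simp: arc_def indicator_def norm_mult norm_power norm_exp_eq_Re)

text \<open>
  Both sides are integrals of the entire function \<open>(1 + z\<^sup>2) exp(-u z)\<close> from \<open>-\<i>\<close> to \<open>\<i>\<close>: along the
  segment on the left, along the right unit semicircle on the right. On the circle
  \<open>1 + z\<^sup>2 = 2 z cos \<theta>\<close>.
\<close>
lemma kern_eq_arc:
  assumes "u > 0"
  shows "kern u = (LINT \<theta>|lborel. arc u \<theta>) / of_real pi"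
proof -
  define w where "w = complex_of_real u"
  have w: "w \<noteq> 0" using assms by (simp add: w_def)
  \<comment> \<open>An explicit primitive of p(z) exp(-w z) for p = 1 + z^2: repeated integration by
    parts gives p/w + p'/w^2 + p''/w^3. By the fundamental theorem of calculus both path integrals
    equal H(i) - H(-i).\<close>
  define H where "H z = - exp (- w * z) * ((1 + z\<^sup>2) / w + 2 * z / w\<^sup>2 + 2 / w ^ 3)" for z
  have H: "(H has_field_derivative (1 + z\<^sup>2) * exp (- w * z)) (at z)" for z
    unfolding H_def using w
    by (auto intro!: derivative_eq_intros simp: field_simps power2_eq_square power3_eq_cube)
  have "((\<lambda>y. \<i> * of_real y) has_vector_derivative \<i>) (at y within A)" for y A
    by (auto intro!: derivative_eq_intros)
  from field_vector_diff_chain_within[OF this has_field_derivative_at_within[OF H]]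
  have "((\<lambda>y. H (\<i> * of_real y)) has_vector_derivative
      \<i> * ((1 + (\<i> * of_real y)\<^sup>2) * exp (- w * (\<i> * of_real y)))) (at y within A)" for y A
    by (simp add: o_def)
  moreover have "\<i> * ((1 + (\<i> * of_real y)\<^sup>2) * exp (- w * (\<i> * of_real y)))
      = \<i> * ((1 - of_real (y\<^sup>2)) * exp (- \<i> * of_real y * of_real u))" for y
    by (simp add: power_mult_distrib w_def mult_ac)
  ultimately have 1: "((\<lambda>y. H (\<i> * of_real y)) has_vector_derivative
      \<i> * ((1 - of_real (y\<^sup>2)) * exp (- \<i> * of_real y * of_real u))) (at y within A)" for y A
    by metis
  have "(LINT y|lborel. indicator {-1..1} y *\<^sub>R (\<i> * ((1 - of_real (y\<^sup>2)) * exp (- \<i> * of_real y * of_real u))))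
      = H (\<i> * of_real 1) - H (\<i> * of_real (-1))"
    by (rule integral_FTC_Icc[OF _ 1]) (auto intro!: continuous_intros)
  then have seg: "\<i> * (of_real (2 * pi) * kern u) = H \<i> - H (- \<i>)"
    by (simp add: kern_def flip: mult_scaleR_right)
  have "(cis has_vector_derivative \<i> * cis \<theta>) (at \<theta> within A)" for \<theta> A
    unfolding has_vector_derivative_def
    by (rule has_derivative_eq_rhs[OF has_derivative_cis[OF has_derivative_ident]]) (auto simp: scaleR_conv_of_real)
  from field_vector_diff_chain_within[OF this has_field_derivative_at_within[OF H]]
  have "((\<lambda>\<theta>. H (cis \<theta>)) has_vector_derivative
      \<i> * cis \<theta> * ((1 + (cis \<theta>)\<^sup>2) * exp (- w * cis \<theta>))) (at \<theta> within A)" for \<theta> A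
    by (simp add: o_def)
  moreover have "1 + (cis \<theta>)\<^sup>2 = 2 * of_real (cos \<theta>) * cis \<theta>" for \<theta>
    using sin_cos_squared_add[of \<theta>]
    by (simp add: complex_eq_iff power2_eq_square algebra_simps)
  ultimately have 2: "((\<lambda>\<theta>. H (cis \<theta>)) has_vector_derivative
      2 * \<i> * (of_real (cos \<theta>) * (cis \<theta>)\<^sup>2 * exp (- of_real u * cis \<theta>))) (at \<theta> within A)" for \<theta> A
    by (simp add: power2_eq_square w_def mult_ac)
  have "(LINT \<theta>|lborel. indicator {-(pi/2)..pi/2} \<theta> *\<^sub>R
      (2 * \<i> * (of_real (cos \<theta>) * (cis \<theta>)\<^sup>2 * exp (- of_real u * cis \<theta>)))) = H (cis (pi/2)) - H (cis (-(pi/2)))"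
    by (rule integral_FTC_Icc[OF _ 2]) (auto intro!: continuous_intros)
  then have "2 * \<i> * (LINT \<theta>|lborel. arc u \<theta>) = H \<i> - H (- \<i>)"
    by (simp add: arc_def cis_minus_pi_half flip: mult_scaleR_right)
  with seg have "2 * \<i> * (of_real pi * kern u) = 2 * \<i> * (LINT \<theta>|lborel. arc u \<theta>)"
    by (simp add: mult_ac)
  then show ?thesis by (simp add: field_simps)
qed

section \<open>Half-line integrals against the kernel\<close>

lemma integral_exp_minus:
  assumes "c > (0::real)"
  shows "integrable lborel (\<lambda>u. indicator {0<..} u *\<^sub>R exp (- (u * c)))"
    and "(LINT u|lborel. indicator {0<..} u *\<^sub>R exp (- (u * c))) = 1 / c"
  using integrable_I0i_exp_mscale[OF assms] LBINT_I0i_exp_mscale[OF assms]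
  by (simp_all add: set_integrable_def interval_lebesgue_integral_0_infty set_lebesgue_integral_def)

lemma integrable_exp_minus_complex:
  assumes "Re z > 0" and [measurable]: "g \<in> borel_measurable borel" and "\<And>u. cmod (g u) \<le> C"
  shows "integrable lborel (\<lambda>u. indicator {0<..} u *\<^sub>R (g u * exp (- of_real u * z)))"
proof (rule Bochner_Integration.integrable_bound)
  show "integrable lborel (\<lambda>u. C * indicator {0<..} u *\<^sub>R exp (- (u * Re z)))"
    using integrable_mult_right[OF integral_exp_minus(1)[OF assms(1)]] by simp
  have "cmod (g u) \<le> \<bar>C\<bar>" for u
    using assms(3)[of u] by linarith
  then show "AE u in lborel. norm (indicator {0<..} u *\<^sub>R (g u * exp (- of_real u * z)))
      \<le> norm (C * indicator {0<..} u *\<^sub>R exp (- (u * Re z)))"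
    by (auto simp: norm_mult norm_exp_eq_Re indicator_def abs_mult)
qed measurable

lemma integral_exp_minus_complex:
  assumes "Re z > 0"
  shows "(LINT u|lborel. indicator {0<..} u *\<^sub>R exp (- of_real u * z)) = 1 / z"
proof -
  have z: "z \<noteq> 0" using assms by auto
  let ?f = "\<lambda>u. indicator {0<..} u *\<^sub>R exp (- of_real u * z)"
  have "integrable lborel ?f"
    using integrable_exp_minus_complex[OF assms, of "\<lambda>_. 1" 1] by simp
  then have lim: "((\<lambda>n. LINT u|lborel. indicator {..n} u *\<^sub>R ?f u) \<longlongrightarrow> (LINT u|lborel. ?f u)) at_top"
    by (intro tendsto_integral_at_top) simp_all
  have "\<forall>\<^sub>F n in at_top. (LINT u|lborel. indicator {..n} u *\<^sub>R ?f u) = 1 / z - exp (- of_real n * z) / z"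
    using eventually_ge_at_top[of 0]
  proof eventually_elim
    case (elim n)
    have "((\<lambda>x. - exp (- x * z) / z) has_field_derivative exp (- of_real u * z)) (at (of_real u))" for u
      using z by (auto intro!: derivative_eq_intros)
    then have "((\<lambda>u. - exp (- of_real u * z) / z) has_vector_derivative exp (- of_real u * z)) (at u within A)" for u A
      using has_vector_derivative_at_within has_vector_derivative_real_field by blast
    then have "(LINT u|lborel. indicator {0..n} u *\<^sub>R exp (- of_real u * z)) =
        - exp (- of_real n * z) / z - (- exp (- of_real 0 * z) / z)"
      by (intro integral_FTC_Icc elim) (auto intro!: continuous_intros)
    moreover have "(LINT u|lborel. indicator {..n} u *\<^sub>R ?f u) = (LINT u|lborel. indicator {0..n} u *\<^sub>R exp (- of_real u * z))"
      by (rule integral_cong_AE, measurable, rule AE_mp[OF AE_lborel_singleton[of 0]])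
        (auto simp: indicator_def)
    ultimately show ?case by simp
  qed
  from Lim_transform_eventually[OF lim this]
  have "((\<lambda>n. 1 / z - exp (- of_real n * z) / z) \<longlongrightarrow> (LINT u|lborel. ?f u)) at_top" .
  moreover have "((\<lambda>n. 1 / z - exp (- of_real n * z) / z) \<longlongrightarrow> 1 / z - 0 / z) at_top"
  proof (intro tendsto_intros z)
    have "((\<lambda>n. exp (- (n * Re z))) \<longlongrightarrow> 0) at_top"
      using assms
      by (auto intro!: exp_at_bot[THEN filterlim_compose] filterlim_tendsto_pos_mult_at_top filterlim_ident
             simp: filterlim_uminus_at_bot mult.commute[of _ "Re z"])
    then have "((\<lambda>n. norm (exp (- of_real n * z))) \<longlongrightarrow> 0) at_top"
      by (simp add: norm_exp_eq_Re)
    then show "((\<lambda>n. exp (- of_real n * z)) \<longlongrightarrow> 0) at_top"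
      by (rule tendsto_norm_zero_cancel)
  qed
  ultimately show ?thesis
    using tendsto_unique[OF trivial_limit_at_top_linorder] by fastforce
qed

text \<open>On the semicircle the modulus of \<open>arc u \<theta>\<close> is
  \<open>cos \<theta> exp(-u cos \<theta>)\<close>, whose integral over u > 0 is 1 however small the
  cosine. So the interchange is dominated up to the endpoints, where the exponential decay is lost
  but \<open>arc\<close> vanishes.\<close>

lemma half_line_kern:
  assumes [measurable]: "g \<in> borel_measurable borel" and C: "\<And>u. cmod (g u) \<le> C"
  shows "integrable lborel (\<lambda>u. indicator {0<..} u *\<^sub>R (g u * kern u))"
    and "(LINT u|lborel. indicator {0<..} u *\<^sub>R (g u * kern u)) =
      (LINT \<theta>|lborel. LINT u|lborel. indicator {0<..} u *\<^sub>R (g u * arc u \<theta>)) / of_real pi"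
    and "integrable lborel (\<lambda>\<theta>. LINT u|lborel. indicator {0<..} u *\<^sub>R (g u * arc u \<theta>))"
proof -
  have C0: "C \<ge> 0" using C[of 0] norm_ge_zero order_trans by blast
  let ?f = "\<lambda>\<theta> u. indicator {0<..} u *\<^sub>R (g u * arc u \<theta>)"
  let ?I = "{-(pi/2)..pi/2}"
  let ?w = "\<lambda>\<theta> u. indicator {0<..} u *\<^sub>R (C * (indicator ?I \<theta> * (cos \<theta> * exp (- (u * cos \<theta>)))))"
  have w: "integrable lborel (?w \<theta>) \<and> (LINT u|lborel. ?w \<theta> u) \<le> C * indicator ?I \<theta>" for \<theta>
  proof (cases "\<theta> \<in> ?I \<and> cos \<theta> \<noteq> 0")
    case True
    then have c: "cos \<theta> > 0" using cos_nonneg_half_pi[of \<theta>] by simp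
    have eq: "?w \<theta> = (\<lambda>u. (C * cos \<theta>) * (indicator {0<..} u *\<^sub>R exp (- (u * cos \<theta>))))"
      using True by (auto simp: mult_ac)
    show ?thesis
      unfolding eq using integral_exp_minus[OF c] True c by simp
  next
    case False
    then have "?w \<theta> = (\<lambda>u. 0)" by (auto simp: indicator_def)
    then show ?thesis using C0 by simp
  qed
  note F = Fubini_dominated[of ?f ?w "\<lambda>\<theta>. C * indicator ?I \<theta>"]
  have prem: "(\<lambda>(\<theta>, u). ?f \<theta> u) \<in> borel_measurable (lborel \<Otimes>\<^sub>M lborel)"
    "AE \<theta> in lborel. integrable lborel (?w \<theta>) \<and> (LINT u|lborel. ?w \<theta> u) \<le> C * indicator ?I \<theta>"
    "\<And>\<theta> u. cmod (?f \<theta> u) \<le> ?w \<theta> u"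
    "integrable lborel (\<lambda>\<theta>. C * indicator ?I \<theta>)"
  proof -
    show "(\<lambda>(\<theta>, u). ?f \<theta> u) \<in> borel_measurable (lborel \<Otimes>\<^sub>M lborel)"
      unfolding split_beta arc_def by measurable
    show "AE \<theta> in lborel. integrable lborel (?w \<theta>) \<and> (LINT u|lborel. ?w \<theta> u) \<le> C * indicator ?I \<theta>"
      using w by blast
    show "cmod (?f \<theta> u) \<le> ?w \<theta> u" for \<theta> u
      unfolding norm_scaleR norm_mult cmod_arc using C[of u] cos_nonneg_half_pi[of \<theta>]
      by (auto simp: indicator_def intro!: mult_right_mono)
    show "integrable lborel (\<lambda>\<theta>. C * indicator ?I \<theta>)" by simp
  qed
  have eq: "(LINT \<theta>|lborel. ?f \<theta> u) / of_real pi = indicator {0<..} u *\<^sub>R (g u * kern u)" for u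
    by (cases "u > 0") (simp_all add: kern_eq_arc)
  show "integrable lborel (\<lambda>u. indicator {0<..} u *\<^sub>R (g u * kern u))"
    unfolding eq[symmetric] using F(3)[OF prem] by simp
  show "(LINT u|lborel. indicator {0<..} u *\<^sub>R (g u * kern u)) =
      (LINT \<theta>|lborel. LINT u|lborel. ?f \<theta> u) / of_real pi"
    unfolding eq[symmetric] F(1)[OF prem] by simp
  show "integrable lborel (\<lambda>\<theta>. LINT u|lborel. ?f \<theta> u)"
    by (rule F(2)[OF prem])
qed

lemma indicator_half_lines_AE:
  fixes f :: "real \<Rightarrow> 'a::real_vector"
  shows "AE u in lborel. f u = indicator {0<..} u *\<^sub>R f u + indicator {0<..} (- u) *\<^sub>R f u"
  by (rule AE_mp[OF AE_lborel_singleton[of 0]]) (auto simp: indicator_def)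

text \<open>The semicircle formula is available for u > 0. Since \<open>kern\<close> is even, the
  negative half-line is folded onto the positive one at the price of reflecting
  \<open>g\<close>.\<close>

lemma integral_symmetric_kern:
  assumes g: "\<And>u. cmod (g u) \<le> C" and [measurable]: "g \<in> borel_measurable borel"
  shows "integrable lborel (\<lambda>u. g u * kern u)"
    and "(LINT u|lborel. g u * kern u) = (LINT u|lborel. indicator {0<..} u *\<^sub>R (g u * kern u)) +
      (LINT u|lborel. indicator {0<..} u *\<^sub>R (g (- u) * kern u))"
proof -
  have pos: "integrable lborel (\<lambda>u. indicator {0<..} u *\<^sub>R (g u * kern u))"
    by (rule half_line_kern[where C = C]) (use g in auto)
  have neg': "integrable lborel (\<lambda>u. indicator {0<..} u *\<^sub>R (g (- u) * kern u))"
    by (rule half_line_kern[where C = C]) (use g in auto)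
  have neg: "integrable lborel (\<lambda>u. indicator {0<..} (- u) *\<^sub>R (g u * kern u))"
    "(LINT u|lborel. indicator {0<..} (- u) *\<^sub>R (g u * kern u)) = (LINT u|lborel. indicator {0<..} u *\<^sub>R (g (- u) * kern u))"
    using lborel_integrable_real_affine[OF neg', of "-1" 0]
      lborel_integral_real_affine[of "-1" "\<lambda>u. indicator {0<..} (- u) *\<^sub>R (g u * kern u)" 0]
    by (simp_all add: kern_minus)
  show "integrable lborel (\<lambda>u. g u * kern u)"
    by (subst integrable_cong_AE[OF _ _ indicator_half_lines_AE])
      (auto intro: pos neg Bochner_Integration.integrable_add)
  have "(LINT u|lborel. g u * kern u) = (LINT u|lborel. indicator {0<..} u *\<^sub>R (g u * kern u) + indicator {0<..} (- u) *\<^sub>R (g u * kern u))"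
    by (rule integral_cong_AE[OF _ _ indicator_half_lines_AE]) auto
  then show "(LINT u|lborel. g u * kern u) = (LINT u|lborel. indicator {0<..} u *\<^sub>R (g u * kern u)) +
      (LINT u|lborel. indicator {0<..} u *\<^sub>R (g (- u) * kern u))"
    using pos neg by simp
qed

lemma integrable_kern: "integrable lborel kern"
  using integral_symmetric_kern(1)[of "\<lambda>_. 1" 1] by simp

text \<open>Integrating exp(-u z) over u > 0 gives 1/z, which reduces the factor
  \<open>cos \<theta> z^2\<close> to \<open>cos \<theta> z\<close>. The latter has integral pi/2
  over the semicircle, so each half-line carries mass 1/2.\<close>

lemma integral_kern: "(LINT u|lborel. kern u) = 1"
proof -
  let ?I = "{-(pi/2)..pi/2}"
  have "(LINT u|lborel. indicator {0<..} u *\<^sub>R arc u \<theta>) = indicator ?I \<theta> *\<^sub>R (of_real (cos \<theta>) * cis \<theta>)" for \<theta>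
  proof (cases "\<theta> \<in> ?I \<and> cos \<theta> \<noteq> 0")
    case True
    then have "cos \<theta> > 0" using cos_nonneg_half_pi[of \<theta>] by simp
    then have J: "(LINT u|lborel. indicator {0<..} u *\<^sub>R exp (- of_real u * cis \<theta>)) = 1 / cis \<theta>"
      by (intro integral_exp_minus_complex) simp
    have eq: "(\<lambda>u. indicator {0<..} u *\<^sub>R arc u \<theta>) =
        (\<lambda>u. (of_real (cos \<theta>) * (cis \<theta>)\<^sup>2) * (indicator {0<..} u *\<^sub>R exp (- of_real u * cis \<theta>)))"
      using True by (auto simp: arc_def)
    have "(LINT u|lborel. indicator {0<..} u *\<^sub>R arc u \<theta>) =
        (of_real (cos \<theta>) * (cis \<theta>)\<^sup>2) * (LINT u|lborel. indicator {0<..} u *\<^sub>R exp (- of_real u * cis \<theta>))"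
      unfolding eq by (rule integral_mult_right_zero)
    also note J
    finally show ?thesis using True by (simp add: power2_eq_square)
  qed (auto simp: arc_def indicator_def)
  then have "(LINT u|lborel. indicator {0<..} u *\<^sub>R kern u) =
      (LINT \<theta>|lborel. indicator ?I \<theta> *\<^sub>R (of_real (cos \<theta>) * cis \<theta>)) / of_real pi"
    using half_line_kern(2)[of "\<lambda>_. 1" 1] by simp
  moreover have "(LINT \<theta>|lborel. indicator ?I \<theta> *\<^sub>R (of_real (cos \<theta>) * cis \<theta>)) =
      (Complex (pi/2/2 + sin (2 * (pi/2)) / 4) ((sin (pi/2))\<^sup>2 / 2)) -
      (Complex (-(pi/2)/2 + sin (2 * (-(pi/2))) / 4) ((sin (-(pi/2)))\<^sup>2 / 2))"
  proof (rule integral_FTC_Icc)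
    have cos2: "cos (\<theta> * 2) = 2 * (cos \<theta> * cos \<theta>) - 1" for \<theta> :: real
      using cos_double_cos[of \<theta>] by (simp add: mult.commute power2_eq_square)
    \<comment> \<open>Real part: a primitive of the squared cosine. Imaginary part: a primitive of
      cosine times sine.\<close>
    show "((\<lambda>\<theta>. Complex (\<theta>/2 + sin (2 * \<theta>) / 4) ((sin \<theta>)\<^sup>2 / 2)) has_vector_derivative
        of_real (cos \<theta>) * cis \<theta>) (at \<theta> within A)" for \<theta> A
      by (auto intro!: derivative_eq_intros simp: has_vector_derivative_complex_iff cos2
          has_real_derivative_iff_has_vector_derivative[symmetric] power2_eq_square field_simps)
    show "continuous_on ?I (\<lambda>\<theta>. of_real (cos \<theta>) * cis \<theta>)" by (auto intro!: continuous_intros)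
  qed auto
  ultimately have "(LINT u|lborel. indicator {0<..} u *\<^sub>R kern u) = 1 / 2"
    by (simp add: complex_eq_iff)
  then show ?thesis
    using integral_symmetric_kern(2)[of "\<lambda>_. 1" 1] by (simp add: mult.commute)
qed

text \<open>
  \<open>(1 - exp(-h z))\<close> times the integral is the Laplace integral of the increments \<open>g u - g (u - h)\<close>.
\<close>
lemma laplace_lipschitz_bound:
  assumes lip: "L-lipschitz_on UNIV g" and g0: "\<And>u. u \<le> 0 \<Longrightarrow> g u = 0"
    and C: "\<And>u. cmod (g u) \<le> C" and z: "Re z > 0"
  shows "cmod (z * (LINT u|lborel. indicator {0<..} u *\<^sub>R (g u * exp (- of_real u * z)))) \<le> L / Re z"
proof -
  have [measurable]: "g \<in> borel_measurable borel"
    by (rule borel_measurable_continuous_onI[OF lipschitz_on_continuous_on[OF lip]])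
  let ?F = "\<lambda>u. g u * exp (- of_real u * z)"
  have eqF: "(\<lambda>u. indicator {0<..} u *\<^sub>R ?F u) = ?F"
    using g0 by (auto simp: indicator_def not_less)
  define I where "I = (LINT u|lborel. ?F u)"
  have int: "integrable lborel ?F"
    using integrable_exp_minus_complex[OF z, of g C] C unfolding eqF by simp
  have bound: "cmod ((1 - exp (- of_real h * z)) / of_real h * I) \<le> L / Re z" if h: "h > 0" for h :: real
  proof -
    let ?G = "\<lambda>u. exp (- of_real h * z) * ?F (u - h)"
    have intG: "integrable lborel ?G"
      using lborel_integrable_real_affine[OF int, of 1 "- h"] by simp
    have "(LINT u|lborel. ?G u) = exp (- of_real h * z) * (LINT u|lborel. ?F (u - h))"
      by (rule integral_mult_right_zero)
    also have "(LINT u|lborel. ?F (u - h)) = I"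
      unfolding I_def using lborel_integral_real_affine[of 1 ?F "- h"] by simp
    finally have "(1 - exp (- of_real h * z)) * I = (LINT u|lborel. ?F u - ?G u)"
      using int intG by (simp add: I_def algebra_simps)
    moreover have "cmod (LINT u|lborel. ?F u - ?G u) \<le>
        (LINT u|lborel. L * h * (indicator {0<..} u *\<^sub>R exp (- (u * Re z))))"
    proof (rule Bochner_Integration.integral_norm_bound_integral)
      show "integrable lborel (\<lambda>u. ?F u - ?G u)" using int intG by (rule Bochner_Integration.integrable_diff)
      show "integrable lborel (\<lambda>u. L * h * (indicator {0<..} u *\<^sub>R exp (- (u * Re z))))"
        using integral_exp_minus(1)[OF z] by simp
      fix u :: real
      have "exp (- of_real h * z) * exp (- of_real (u - h) * z) = exp (- of_real u * z)"
        unfolding exp_add[symmetric] by (simp add: algebra_simps)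
      then have "?F u - ?G u = (g u - g (u - h)) * exp (- of_real u * z)"
        by (simp add: algebra_simps)
      moreover have "cmod (g u - g (u - h)) \<le> L * h"
        using lipschitz_onD[OF lip, of u "u - h"] h by (simp add: dist_norm)
      moreover have "g u - g (u - h) = 0" if "u \<le> 0" using g0 that h by simp
      ultimately show "norm (?F u - ?G u) \<le> L * h * (indicator {0<..} u *\<^sub>R exp (- (u * Re z)))"
        by (auto simp: norm_mult norm_exp_eq_Re indicator_def not_less intro!: mult_right_mono)
    qed
    ultimately have "cmod ((1 - exp (- of_real h * z)) * I) \<le> L * h * (1 / Re z)"
      using integral_exp_minus(2)[OF z] by simp
    then show ?thesis
      using h by (simp add: norm_mult norm_divide field_simps)
  qed
  \<comment> \<open>Letting h tend to 0 turns the factor into \<open>z\<close>. This stands in for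
    the integration by parts that would replace \<open>g\<close> by its derivative, for a
    \<open>g\<close> that is only Lipschitz.\<close>
  have "((\<lambda>w. exp (- w * z)) has_field_derivative - z) (at 0)"
    by (auto intro!: derivative_eq_intros)
  then have "((\<lambda>w. (exp (- w * z) - 1) / w) \<longlongrightarrow> - z) (at 0)"
    by (simp add: has_field_derivative_iff)
  then have "((\<lambda>w. - ((exp (- w * z) - 1) / w)) \<longlongrightarrow> - (- z)) (at 0)"
    by (rule tendsto_minus)
  then have "((\<lambda>w. (1 - exp (- w * z)) / w) \<longlongrightarrow> z) (at 0)"
    by (simp add: minus_divide_left)
  moreover have "filterlim of_real (at (0::complex)) (at_right (0::real))"
    by (auto simp: filterlim_at eventually_at_filter intro!: tendsto_eq_intros)
  ultimately have "((\<lambda>h. (1 - exp (- of_real h * z)) / of_real h) \<longlongrightarrow> z) (at_right (0::real))"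
    by (rule filterlim_compose)
  then have "((\<lambda>h. cmod ((1 - exp (- of_real h * z)) / of_real h * I)) \<longlongrightarrow> cmod (z * I)) (at_right (0::real))"
    by (intro tendsto_intros)
  moreover have "\<forall>\<^sub>F h in at_right 0. cmod ((1 - exp (- of_real h * z)) / of_real h * I) \<le> L / Re z"
    unfolding eventually_at_filter using bound by (auto intro!: always_eventually)
  ultimately have "cmod (z * I) \<le> L / Re z"
    by (intro tendsto_upperbound) auto
  then show ?thesis unfolding eqF I_def .
qed

text \<open>At z = \<open>cis \<theta>\<close> the Laplace bound is \<open>L / cos \<theta>\<close>,
  and the factor \<open>cos \<theta>\<close> of \<open>arc\<close> cancels it: every angle
  contributes at most \<open>L\<close>. The semicircle has length pi, which the division by pi
  undoes.\<close>

lemma half_line_kern_bound: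
  assumes lip: "L-lipschitz_on UNIV g" and g0: "\<And>u. u \<le> 0 \<Longrightarrow> g u = 0" and C: "\<And>u. cmod (g u) \<le> C"
  shows "cmod (LINT u|lborel. indicator {0<..} u *\<^sub>R (g u * kern u)) \<le> L"
proof -
  have [measurable]: "g \<in> borel_measurable borel"
    by (rule borel_measurable_continuous_onI[OF lipschitz_on_continuous_on[OF lip]])
  have L: "L \<ge> 0" using lip lipschitz_on_nonneg by blast
  let ?I = "{-(pi/2)..pi/2}"
  let ?J = "\<lambda>\<theta>. LINT u|lborel. indicator {0<..} u *\<^sub>R (g u * arc u \<theta>)"
  have "cmod (?J \<theta>) \<le> L * indicator ?I \<theta>" for \<theta>
  proof (cases "\<theta> \<in> ?I \<and> cos \<theta> \<noteq> 0")
    case True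
    then have c: "cos \<theta> > 0" using cos_nonneg_half_pi[of \<theta>] by simp
    have eq: "(\<lambda>u. indicator {0<..} u *\<^sub>R (g u * arc u \<theta>)) = (\<lambda>u. (of_real (cos \<theta>) * (cis \<theta>)\<^sup>2) *
        (indicator {0<..} u *\<^sub>R (g u * exp (- of_real u * cis \<theta>))))"
      using True by (auto simp: arc_def)
    define I where "I = (LINT u|lborel. indicator {0<..} u *\<^sub>R (g u * exp (- of_real u * cis \<theta>)))"
    \<comment> \<open>One of the two factors \<open>cis \<theta>\<close> joins \<open>I\<close> to
      form the quantity bounded by \<open>laplace_lipschitz_bound\<close>; the other has modulus
      one.\<close>
    have "?J \<theta> = (of_real (cos \<theta>) * cis \<theta>) * (cis \<theta> * I)"
      unfolding eq integral_mult_right_zero I_def by (simp only: power2_eq_square mult.assoc)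
    then have "cmod (?J \<theta>) = cos \<theta> * cmod (cis \<theta> * I)"
      using c by (simp add: norm_mult)
    also have "\<dots> \<le> cos \<theta> * (L / cos \<theta>)"
      using laplace_lipschitz_bound[OF lip g0 C, of "cis \<theta>"] c
      by (intro mult_left_mono) (simp_all add: I_def)
    finally show ?thesis using c True by simp
  next
    case False
    then have "arc u \<theta> = 0" for u by (auto simp: arc_def)
    then show ?thesis using L by simp
  qed
  then have "cmod (LINT \<theta>|lborel. ?J \<theta>) \<le> (LINT \<theta>|lborel. L * indicator ?I \<theta>)"
    using half_line_kern(3)[OF _ C] by (intro Bochner_Integration.integral_norm_bound_integral) auto
  also have "\<dots> = L * pi" by simp
  finally have "cmod ((LINT \<theta>|lborel. ?J \<theta>) / of_real pi) \<le> L"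
    by (simp add: norm_divide field_simps)
  then show ?thesis
    using half_line_kern(2)[OF _ C] by simp
qed

text \<open>As \<open>kern\<close> has integral 1, the difference is the integral of the increments
  \<open>s (T + u / R) - s T\<close> against \<open>kern\<close>. These are Lipschitz in u with
  constant \<open>M / R\<close> and vanish at u = 0, so each half-line costs at most
  \<open>M / R\<close>.\<close>

lemma kern_approximation:
  assumes lip: "M-lipschitz_on UNIV s" and C: "\<And>t. cmod (s t) \<le> C" and R: "R > 0"
  shows "cmod ((LINT u|lborel. s (T + u / R) * kern u) - s T) \<le> 2 * M / R"
proof -
  have [measurable]: "s \<in> borel_measurable borel"
    by (rule borel_measurable_continuous_onI[OF lipschitz_on_continuous_on[OF lip]])
  have M: "M \<ge> 0" using lip lipschitz_on_nonneg by blast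
  define D where "D u = s (T + u / R) - s T" for u
  have [measurable]: "D \<in> borel_measurable borel" unfolding D_def by measurable
  have D: "cmod (D u) \<le> 2 * C" for u
    unfolding D_def using norm_triangle_ineq4[of "s (T + u / R)" "s T"] C[of T] C[of "T + u / R"] by linarith
  have D_lip: "cmod (D u - D v) \<le> M / R * \<bar>u - v\<bar>" for u v
    using lipschitz_onD[OF lip, of "T + u / R" "T + v / R"] R
    by (simp add: D_def dist_norm flip: diff_divide_distrib)
  have half: "cmod (LINT u|lborel. indicator {0<..} u *\<^sub>R (D (c * u) * kern u)) \<le> M / R" if c: "\<bar>c\<bar> = 1" for c
  proof -
    \<comment> \<open>\<open>max 0 u\<close> continues the increment by zero to u <= 0 and keeps the
      Lipschitz constant, as \<open>half_line_kern_bound\<close> requires; c = 1 and c = -1 give the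
      two half-lines.\<close>
    have "(M / R)-lipschitz_on UNIV (\<lambda>u. D (c * max 0 u))"
    proof (rule lipschitz_onI)
      fix u v :: real
      have "cmod (D (c * max 0 u) - D (c * max 0 v)) \<le> M / R * \<bar>c * max 0 u - c * max 0 v\<bar>" by (rule D_lip)
      also have "\<bar>c * max 0 u - c * max 0 v\<bar> = \<bar>max 0 u - max 0 v\<bar>"
        using c by (metis abs_mult mult_1 right_diff_distrib)
      also have "M / R * \<dots> \<le> M / R * \<bar>u - v\<bar>"
        using M R by (intro mult_left_mono) auto
      finally show "dist (D (c * max 0 u)) (D (c * max 0 v)) \<le> M / R * dist u v"
        by (simp add: dist_norm)
    qed (use M R in auto)
    from half_line_kern_bound[OF this, of "2 * C"]
    have "cmod (LINT u|lborel. indicator {0<..} u *\<^sub>R (D (c * max 0 u) * kern u)) \<le> M / R"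
      using D by (simp add: D_def)
    also have "(\<lambda>u. indicator {0<..} u *\<^sub>R (D (c * max 0 u) * kern u)) = (\<lambda>u. indicator {0<..} u *\<^sub>R (D (c * u) * kern u))"
      by (intro ext) (simp add: indicator_def max_def)
    finally show ?thesis .
  qed
  have "(LINT u|lborel. s (T + u / R) * kern u) - s T = (LINT u|lborel. s (T + u / R) * kern u) - (LINT u|lborel. s T * kern u)"
    by (simp add: integral_kern)
  also have "\<dots> = (LINT u|lborel. D u * kern u)"
    using integral_symmetric_kern(1)[of "\<lambda>u. s (T + u / R)" C] C integrable_kern
    by (simp add: D_def algebra_simps)
  also have "\<dots> = (LINT u|lborel. indicator {0<..} u *\<^sub>R (D u * kern u)) + (LINT u|lborel. indicator {0<..} u *\<^sub>R (D (- u) * kern u))"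
    by (rule integral_symmetric_kern(2)[OF D]) simp
  finally show ?thesis
    using half[of 1] half[of "-1"]
      norm_triangle_ineq[of "LINT u|lborel. indicator {0<..} u *\<^sub>R (D u * kern u)" "LINT u|lborel. indicator {0<..} u *\<^sub>R (D (- u) * kern u)"]
    by simp
qed

section \<open>A Tauberian theorem for Lipschitz functions\<close>

text \<open>For R > 0 this is, up to a factor R, the convolution of \<open>\<psi>\<close> with the
  parabola \<open>1 - y^2/R^2\<close> on [-R, R]: a smooth substitute whose support exceeds that
  interval only by the radius of the support of \<open>\<psi>\<close>.\<close>

definition para :: "real \<Rightarrow> (real \<Rightarrow> complex) \<Rightarrow> real \<Rightarrow> complex" where
  "para R \<psi> y = integral {-1..1} (\<lambda>v. (1 - of_real (v\<^sup>2)) * \<psi> (y - R * v))"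

lemma smooth_para: "smooth \<psi> \<Longrightarrow> smooth (para R \<psi>)"
  unfolding para_def[abs_def] by (rule smooth_convolution) (auto intro!: continuous_intros)

lemma para_zero_outside:
  assumes "\<And>y. \<bar>y\<bar> > r \<Longrightarrow> \<psi> y = 0" "R \<ge> 0" "\<bar>y\<bar> > R + r"
  shows "para R \<psi> y = 0"
proof -
  have "\<psi> (y - R * v) = 0" if "v \<in> {-1..1}" for v
  proof (rule assms(1))
    have "\<bar>R * v\<bar> \<le> R" using that \<open>R \<ge> 0\<close> by (simp add: abs_mult mult_left_le abs_le_iff)
    then show "\<bar>y - R * v\<bar> > r" using assms(3) by linarith
  qed
  then have "para R \<psi> y = integral {-1..1::real} (\<lambda>v. 0)"
    unfolding para_def by (intro Henstock_Kurzweil_Integration.integral_cong) simp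
  then show ?thesis by simp
qed

lemma fourier_para:
  assumes "smooth \<psi>" "\<And>y. \<bar>y\<bar> > r \<Longrightarrow> \<psi> y = 0"
  shows "fourier (para R \<psi>) t = 2 * of_real pi * kern (R * t) * fourier \<psi> t"
proof -
  have "exp (- \<i> * of_real (R * v) * of_real t) = exp (- \<i> * of_real v * of_real (R * t))" for v
    by (simp add: mult_ac)
  then show ?thesis
    unfolding para_def[abs_def]
    by (subst fourier_convolution[OF assms]) (auto intro!: continuous_intros simp: kern_def)
qed

text \<open>A nonnegative bump of mass one has transform bounded by 1, and if it lives on
  [-\<epsilon>, \<epsilon>] its transform differs from 1 by at most \<epsilon> |t|. So the
  transforms of shrinking bumps tend to 1 pointwise, and dominated convergence makes
  \<open>kern\<close> times the transform close to \<open>kern\<close> in L^1.\<close>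

lemma exists_approximate_bump:
  fixes R r \<delta> :: real
  assumes "R > 0" "r > 0" "\<delta> > 0"
  obtains \<psi> where "smooth \<psi>" "\<And>y. \<bar>y\<bar> > r \<Longrightarrow> \<psi> y = 0" "\<And>t. cmod (fourier \<psi> t) \<le> 1"
    "(LINT u|lborel. cmod (kern u) * cmod (1 - fourier \<psi> (u / R))) < \<delta>"
proof -
  define \<epsilon> where "\<epsilon> n = r / real (Suc n)" for n
  have eps: "\<epsilon> n > 0" "\<epsilon> n \<le> r" for n
    unfolding \<epsilon>_def using \<open>r > 0\<close> by (simp_all add: field_simps)
  have "\<exists>\<psi>. smooth \<psi> \<and> (\<forall>y. \<bar>y\<bar> > \<epsilon> n \<longrightarrow> \<psi> y = 0) \<and> (\<forall>t. cmod (fourier \<psi> t) \<le> 1) \<and>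
      (\<forall>t. cmod (1 - fourier \<psi> t) \<le> \<epsilon> n * \<bar>t\<bar>)" for n
  proof -
    obtain \<psi> :: "real \<Rightarrow> real" where \<psi>: "smooth (\<lambda>y. of_real (\<psi> y))" "\<And>y. \<psi> y \<ge> 0"
      "\<And>y. \<bar>y\<bar> > \<epsilon> n \<Longrightarrow> \<psi> y = 0" "integrable lborel \<psi>" "(LINT y|lborel. \<psi> y) = 1"
      using exists_bump[OF eps(1)] by blast
    let ?\<psi> = "\<lambda>y. complex_of_real (\<psi> y)"
    have int: "integrable lborel ?\<psi>" using \<psi>(4) by simp
    have "cmod (fourier ?\<psi> t) \<le> 1" for t
      using cmod_fourier_le[OF int, of t] \<psi>(2,5) by simp
    moreover have "cmod (1 - fourier ?\<psi> t) \<le> \<epsilon> n * \<bar>t\<bar>" for t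
    proof -
      have "1 - fourier ?\<psi> t = (LINT y|lborel. ?\<psi> y - ?\<psi> y * exp (- \<i> * of_real y * of_real t))"
        using integrable_mult_exp_ii[OF int] int \<psi>(5)
        by (simp add: fourier_eq_lborel[OF smooth_measurable[OF \<psi>(1)]])
      also have "cmod \<dots> \<le> (LINT y|lborel. \<epsilon> n * \<bar>t\<bar> * \<psi> y)"
      proof (rule Bochner_Integration.integral_norm_bound_integral)
        show "integrable lborel (\<lambda>y. ?\<psi> y - ?\<psi> y * exp (- \<i> * of_real y * of_real t))"
          by (intro Bochner_Integration.integrable_diff integrable_mult_exp_ii int)
        show "integrable lborel (\<lambda>y. \<epsilon> n * \<bar>t\<bar> * \<psi> y)" using \<psi>(4) by simp
        fix y :: real
        show "cmod (?\<psi> y - ?\<psi> y * exp (- \<i> * of_real y * of_real t)) \<le> \<epsilon> n * \<bar>t\<bar> * \<psi> y"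
        proof (cases "\<bar>y\<bar> > \<epsilon> n")
          case False
          \<comment> \<open>By \<open>dist_exp_i_1\<close> the left side is twice the modulus of the
            sine of half the angle.\<close>
          have "cmod (exp (\<i> * of_real (- (y * t))) - 1) \<le> \<bar>y * t\<bar>"
            using abs_sin_x_le_abs_x[of "y * t / 2"] unfolding dist_exp_i_1 by simp
          also have "\<dots> \<le> \<epsilon> n * \<bar>t\<bar>"
            unfolding abs_mult using False by (intro mult_right_mono) auto
          finally have "cmod (exp (\<i> * of_real (- (y * t))) - 1) \<le> \<epsilon> n * \<bar>t\<bar>" .
          moreover have "?\<psi> y - ?\<psi> y * exp (- \<i> * of_real y * of_real t) =
              - (of_real (\<psi> y) * (exp (\<i> * of_real (- (y * t))) - 1))"
            by (simp add: algebra_simps)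
          ultimately have "cmod (?\<psi> y - ?\<psi> y * exp (- \<i> * of_real y * of_real t)) \<le> \<psi> y * (\<epsilon> n * \<bar>t\<bar>)"
            using \<psi>(2)[of y] by (simp only: norm_minus_cancel norm_mult norm_of_real abs_of_nonneg mult_left_mono)
          then show ?thesis by (simp only: mult.commute)
        qed (simp add: \<psi>(3))
      qed
      also have "\<dots> = \<epsilon> n * \<bar>t\<bar>" using \<psi>(4,5) by simp
      finally show ?thesis .
    qed
    ultimately show ?thesis using \<psi>(1,3) by (intro exI[of _ ?\<psi>]) auto
  qed
  then obtain \<psi> where \<psi>: "\<And>n. smooth (\<psi> n)" "\<And>n y. \<bar>y\<bar> > \<epsilon> n \<Longrightarrow> \<psi> n y = 0"
    "\<And>n t. cmod (fourier (\<psi> n) t) \<le> 1" "\<And>n t. cmod (1 - fourier (\<psi> n) t) \<le> \<epsilon> n * \<bar>t\<bar>"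
    by metis
  note [measurable] = smooth_measurable[OF \<psi>(1)]
  have "(\<lambda>n. LINT u|lborel. cmod (kern u) * cmod (1 - fourier (\<psi> n) (u / R))) \<longlonglongrightarrow> (LINT u::real|lborel. 0)"
  proof (rule integral_dominated_convergence[where w = "\<lambda>u. 2 * cmod (kern u)"])
    show "integrable lborel (\<lambda>u. 2 * cmod (kern u))" using integrable_kern by simp
    have "(\<lambda>n. cmod (kern u) * cmod (1 - fourier (\<psi> n) (u / R))) \<longlonglongrightarrow> 0" for u
    proof (rule tendsto_mult_right_zero, rule tendsto_sandwich[OF _ _ tendsto_const])
      show "\<forall>\<^sub>F n in sequentially. cmod (1 - fourier (\<psi> n) (u / R)) \<le> \<epsilon> n * \<bar>u / R\<bar>"
        using \<psi>(4) by (intro always_eventually allI)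
      have "(\<lambda>n. r * inverse (real (Suc n))) \<longlonglongrightarrow> 0"
        by (rule tendsto_mult_right_zero[OF LIMSEQ_inverse_real_of_nat])
      then show "(\<lambda>n. \<epsilon> n * \<bar>u / R\<bar>) \<longlonglongrightarrow> 0"
        unfolding \<epsilon>_def divide_inverse by (rule tendsto_mult_left_zero)
    qed simp
    then show "AE u in lborel. (\<lambda>n. cmod (kern u) * cmod (1 - fourier (\<psi> n) (u / R))) \<longlonglongrightarrow> 0"
      by simp
    have two: "cmod (1 - fourier (\<psi> n) t) \<le> 2" for n t
      using norm_triangle_ineq4[of 1 "fourier (\<psi> n) t"] \<psi>(3)[of n t] by simp
    have "cmod (kern u) * cmod (1 - fourier (\<psi> n) (u / R)) \<le> 2 * cmod (kern u)" for n u
      using mult_left_mono[OF two[of n "u / R"] norm_ge_zero[of "kern u"]] by (simp only: mult.commute)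
    then show "AE u in lborel. norm (cmod (kern u) * cmod (1 - fourier (\<psi> n) (u / R))) \<le> 2 * cmod (kern u)" for n
      by simp
  qed measurable
  then have "\<forall>\<^sub>F n in sequentially. (LINT u|lborel. cmod (kern u) * cmod (1 - fourier (\<psi> n) (u / R))) < \<delta>"
    using \<open>\<delta> > 0\<close> by (intro order_tendstoD(2)[of _ 0]) simp_all
  then obtain n where "(LINT u|lborel. cmod (kern u) * cmod (1 - fourier (\<psi> n) (u / R))) < \<delta>"
    by (auto simp: eventually_sequentially)
  then show ?thesis
    using \<psi>(1-3)[of n] eps(2)[of n] by (intro that[of "\<psi> n"]) auto
qed

text \<open>The substitution t = T + u / R centers the kernel at T and exhibits it as
  \<open>kern\<close> times a factor near 1. The factor 2 pi undoes the normalization of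
  \<open>kern\<close>, and 1 / R is the Jacobian.\<close>

lemma convolution_para:
  assumes "smooth \<psi>" "\<And>y. \<bar>y\<bar> > r \<Longrightarrow> \<psi> y = 0" "R > 0"
  shows "(LINT t|lborel. s t * fourier (para R \<psi>) (t - T)) =
    of_real (2 * pi / R) * (LINT u|lborel. s (T + u / R) * (kern u * fourier \<psi> (u / R)))"
proof -
  have "(LINT t|lborel. s t * fourier (para R \<psi>) (t - T)) =
      (1 / R) *\<^sub>R (LINT u|lborel. s (T + u / R) * (2 * of_real pi * kern u * fourier \<psi> (u / R)))"
    using \<open>R > 0\<close>
    by (subst lborel_integral_real_affine[of "1 / R" _ T]) (simp_all add: fourier_para[OF assms(1,2)])
  also have "(LINT u|lborel. s (T + u / R) * (2 * of_real pi * kern u * fourier \<psi> (u / R))) =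
      (LINT u|lborel. of_real (2 * pi) * (s (T + u / R) * (kern u * fourier \<psi> (u / R))))"
    by (simp add: mult_ac)
  also have "\<dots> = of_real (2 * pi) * (LINT u|lborel. s (T + u / R) * (kern u * fourier \<psi> (u / R)))"
    by (rule integral_mult_right_zero)
  finally show ?thesis by (simp add: scaleR_conv_of_real)
qed

lemma kern_fourier_integrable:
  assumes "smooth \<psi>" "\<And>t. cmod (fourier \<psi> t) \<le> 1"
    and [measurable]: "g \<in> borel_measurable borel" and "\<And>u. cmod (g u) \<le> C"
  shows "integrable lborel (\<lambda>u. g u * (kern u * fourier \<psi> (u / R)))"
proof (rule Bochner_Integration.integrable_bound)
  show "integrable lborel (\<lambda>u. C * cmod (kern u))" using integrable_kern by simp
  note [measurable] = smooth_measurable[OF assms(1)]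
  show "(\<lambda>u. g u * (kern u * fourier \<psi> (u / R))) \<in> borel_measurable lborel" by measurable
  have "C \<ge> 0" using assms(4) norm_ge_zero order_trans by blast
  have "cmod (g u) * (cmod (kern u) * cmod (fourier \<psi> (u / R))) \<le> C * (cmod (kern u) * 1)" for u
    using \<open>C \<ge> 0\<close> by (intro mult_mono assms mult_nonneg_nonneg) auto
  then show "AE u in lborel. norm (g u * (kern u * fourier \<psi> (u / R))) \<le> norm (C * cmod (kern u))"
    using \<open>C \<ge> 0\<close> by (simp add: norm_mult)
qed

lemma kern_fourier_difference:
  assumes "smooth \<psi>" "\<And>t. cmod (fourier \<psi> t) \<le> 1"
    and [measurable]: "g \<in> borel_measurable borel" and C: "\<And>u. cmod (g u) \<le> C"
  shows "cmod ((LINT u|lborel. g u * kern u) - (LINT u|lborel. g u * (kern u * fourier \<psi> (u / R))))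
    \<le> C * (LINT u|lborel. cmod (kern u) * cmod (1 - fourier \<psi> (u / R)))"
proof -
  note int = kern_fourier_integrable[OF assms(1-3) C] integral_symmetric_kern(1)[OF C]
  have "(LINT u|lborel. g u * kern u) - (LINT u|lborel. g u * (kern u * fourier \<psi> (u / R))) =
      (LINT u|lborel. g u * kern u - g u * (kern u * fourier \<psi> (u / R)))"
    using int by simp
  also have "cmod \<dots> \<le> (LINT u|lborel. C * (cmod (kern u) * cmod (1 - fourier \<psi> (u / R))))"
  proof (rule Bochner_Integration.integral_norm_bound_integral)
    show "integrable lborel (\<lambda>u. g u * kern u - g u * (kern u * fourier \<psi> (u / R)))"
      using int by simp
    have "integrable lborel (\<lambda>u. cmod (kern u - 1 * (kern u * fourier \<psi> (u / R))))"
      by (intro integrable_norm Bochner_Integration.integrable_diff integrable_kern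
          kern_fourier_integrable[OF assms(1,2), where C = 1]) simp_all
    then show "integrable lborel (\<lambda>u. C * (cmod (kern u) * cmod (1 - fourier \<psi> (u / R))))"
      by (simp add: right_diff_distrib flip: norm_mult)
    fix u
    have "cmod (g u * kern u - g u * (kern u * fourier \<psi> (u / R))) =
        cmod (g u) * (cmod (kern u) * cmod (1 - fourier \<psi> (u / R)))"
      by (simp add: right_diff_distrib flip: norm_mult)
    also have "\<dots> \<le> C * (cmod (kern u) * cmod (1 - fourier \<psi> (u / R)))"
      using C by (intro mult_right_mono) auto
    finally show "cmod (g u * kern u - g u * (kern u * fourier \<psi> (u / R))) \<le>
        C * (cmod (kern u) * cmod (1 - fourier \<psi> (u / R)))" .
  qed
  finally show ?thesis by simp
qed

text \<open>Freezing s(t) at s(T) in the convolution changes it by at most \<open>M\<close> times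
  the integral of |v| against the modulus of \<open>fourier \<phi>\<close>, whatever T is. So s(T)
  times the integral of \<open>fourier \<phi>\<close> is bounded as soon as the convolution
  is.\<close>

lemma eventually_bounded_of_convolution:
  assumes lip: "M-lipschitz_on UNIV s" and \<phi>: "smooth \<phi>" "\<And>y. \<bar>y\<bar> > r \<Longrightarrow> \<phi> y = 0"
    and N: "(LINT t|lborel. fourier \<phi> t) \<noteq> 0"
    and lim: "((\<lambda>T. LINT t|lborel. s t * fourier \<phi> (t - T)) \<longlongrightarrow> 0) at_top"
  shows "\<exists>C. \<forall>\<^sub>F T in at_top. cmod (s T) \<le> C"
proof -
  have [measurable]: "s \<in> borel_measurable borel"
    by (rule borel_measurable_continuous_onI[OF lipschitz_on_continuous_on[OF lip]])
  note [measurable] = smooth_measurable[OF \<phi>(1)]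
  have M: "M \<ge> 0" using lip lipschitz_on_nonneg by blast
  define F where "F = fourier \<phi>"
  have [measurable]: "F \<in> borel_measurable borel" unfolding F_def by measurable
  define N where "N = (LINT t|lborel. F t)"
  define K where "K = (LINT t|lborel. (1 + \<bar>t\<bar>) * cmod (F t))"
  have F: "integrable lborel F" unfolding F_def by (rule fourier_integrable[OF \<phi>])
  have wF: "integrable lborel (\<lambda>t. M * ((1 + \<bar>t\<bar>) * cmod (F t)))"
    unfolding F_def using weighted_fourier_integrable[OF \<phi>] by simp
  have bound: "cmod (s T) * cmod N \<le> cmod (LINT t|lborel. s t * F (t - T)) + M * K" for T
  proof -
    have le: "cmod ((s (T + v) - s T) * F v) \<le> M * ((1 + \<bar>v\<bar>) * cmod (F v))" for v
    proof -
      have "cmod (s (T + v) - s T) \<le> M * \<bar>v\<bar>"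
        using lipschitz_onD[OF lip, of "T + v" T] by (simp add: dist_norm)
      also have "\<dots> \<le> M * (1 + \<bar>v\<bar>)" using M by (intro mult_left_mono) auto
      finally show ?thesis unfolding norm_mult mult.assoc[symmetric] by (rule mult_right_mono) simp
    qed
    have int: "integrable lborel (\<lambda>v. (s (T + v) - s T) * F v)"
    proof (rule Bochner_Integration.integrable_bound[OF wF])
      have "cmod ((s (T + v) - s T) * F v) \<le> norm (M * ((1 + \<bar>v\<bar>) * cmod (F v)))" for v
        by (rule order_trans[OF le]) simp
      then show "AE v in lborel. cmod ((s (T + v) - s T) * F v) \<le> norm (M * ((1 + \<bar>v\<bar>) * cmod (F v)))"
        by blast
    qed measurable
    have "(LINT t|lborel. s t * F (t - T)) = (LINT v|lborel. s (T + v) * F v)"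
      by (subst lborel_integral_real_affine[of 1 _ T]) simp_all
    also have "\<dots> = (LINT v|lborel. (s (T + v) - s T) * F v + s T * F v)"
      by (simp add: algebra_simps)
    also have "\<dots> = (LINT v|lborel. (s (T + v) - s T) * F v) + s T * N"
      using int F by (simp add: N_def)
    finally have "s T * N = (LINT t|lborel. s t * F (t - T)) - (LINT v|lborel. (s (T + v) - s T) * F v)"
      by simp
    then have "cmod (s T) * cmod N \<le> cmod (LINT t|lborel. s t * F (t - T)) + cmod (LINT v|lborel. (s (T + v) - s T) * F v)"
      using norm_triangle_ineq4 by (simp only: flip: norm_mult)
    also have "cmod (LINT v|lborel. (s (T + v) - s T) * F v) \<le> (LINT t|lborel. M * ((1 + \<bar>t\<bar>) * cmod (F t)))"
      by (rule Bochner_Integration.integral_norm_bound_integral[OF int wF le])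
    also have "\<dots> = M * K" by (simp add: K_def)
    finally show ?thesis by simp
  qed
  have "\<forall>\<^sub>F T in at_top. cmod (LINT t|lborel. s t * F (t - T)) < 1"
    using tendsto_norm[OF lim] unfolding F_def by (rule order_tendstoD(2)) simp
  then have "\<forall>\<^sub>F T in at_top. cmod (s T) \<le> (1 + M * K) / cmod N"
  proof eventually_elim
    case (elim T)
    have "cmod N > 0" using N by (simp add: N_def F_def)
    then show ?case using bound[of T] elim by (simp add: field_simps)
  qed
  then show ?thesis by blast
qed

lemma lipschitz_tauberian:
  assumes "B > 0" and lip: "M-lipschitz_on UNIV s" and neg: "\<And>t. t \<le> 0 \<Longrightarrow> s t = c"
    and conv: "\<And>\<phi> r. smooth \<phi> \<Longrightarrow> r < B \<Longrightarrow> (\<And>y. \<bar>y\<bar> > r \<Longrightarrow> \<phi> y = 0) \<Longrightarrow>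
      ((\<lambda>T. LINT t|lborel. s t * fourier \<phi> (t - T)) \<longlongrightarrow> 0) at_top"
  shows "Limsup at_top (\<lambda>T. ereal (cmod (s T))) \<le> ereal (2 * M / B)"
proof -
  have [measurable]: "s \<in> borel_measurable borel"
    by (rule borel_measurable_continuous_onI[OF lipschitz_on_continuous_on[OF lip]])
  have M: "M \<ge> 0" using lip lipschitz_on_nonneg by blast
  have "\<exists>C. \<forall>t. cmod (s t) \<le> C"
  proof -
    \<comment> \<open>With a bump of radius R as well, \<open>para\<close> is supported in
      [-2R, 2R], which is well inside (-B, B).\<close>
    define R where "R = B / 4"
    have R: "R > 0" "R + R < B" using \<open>B > 0\<close> by (simp_all add: R_def)
    obtain \<psi> where \<psi>: "smooth \<psi>" "\<And>y. \<bar>y\<bar> > R \<Longrightarrow> \<psi> y = 0" "\<And>t. cmod (fourier \<psi> t) \<le> 1"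
      "(LINT u|lborel. cmod (kern u) * cmod (1 - fourier \<psi> (u / R))) < 1"
      using exists_approximate_bump[OF R(1) R(1), of 1] by auto
    have zero: "para R \<psi> y = 0" if "\<bar>y\<bar> > R + R" for y
      using para_zero_outside[of R \<psi> R y] \<psi>(2) R(1) that by simp
    \<comment> \<open>The integral of \<open>kern\<close> is 1, and the mollification changes it by
      less than 1.\<close>
    have "(LINT u|lborel. kern u * fourier \<psi> (u / R)) \<noteq> 0"
      using kern_fourier_difference[OF \<psi>(1,3), where g = "\<lambda>_. 1" and C = 1 and R = R] \<psi>(4) by (auto simp: integral_kern)
    then have "(LINT t|lborel. fourier (para R \<psi>) t) \<noteq> 0"
      using convolution_para[OF \<psi>(1,2) R(1), where s = "\<lambda>_. 1" and T = 0] R(1) by simp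
    then have "\<exists>C. \<forall>\<^sub>F T in at_top. cmod (s T) \<le> C"
      by (intro eventually_bounded_of_convolution[OF lip smooth_para[OF \<psi>(1)], of "R + R"]
          conv[OF smooth_para[OF \<psi>(1)] R(2)]) (use zero in auto)
    then obtain C T\<^sub>0 where C: "\<And>T. T \<ge> T\<^sub>0 \<Longrightarrow> cmod (s T) \<le> C"
      by (auto simp: eventually_at_top_linorder)
    \<comment> \<open>The bound so far concerns large t only; continuity covers the compact stretch
      before, and \<open>s\<close> is constant for t <= 0.\<close>
    have "compact (s ` {0..T\<^sub>0})"
      by (intro compact_continuous_image lipschitz_on_continuous_on[OF lipschitz_on_subset[OF lip]]) auto
    then obtain C' where C': "\<forall>t\<in>{0..T\<^sub>0}. cmod (s t) \<le> C'"
      by (auto dest!: compact_imp_bounded simp: bounded_iff)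
    have "cmod (s t) \<le> max C (max C' (cmod c))" for t
      using C[of t] bspec[OF C', of t] neg[of t] by (cases "t \<le> 0"; cases "t \<ge> T\<^sub>0") auto
    then show ?thesis by blast
  qed
  then obtain C where C: "\<And>t. cmod (s t) \<le> C" by blast
  have C0: "C \<ge> 0" using C[of 0] norm_ge_zero order_trans by blast
  have ev: "\<forall>\<^sub>F T in at_top. cmod (s T) \<le> 2 * M / R + (C + 1) * \<delta>" if R: "0 < R" "R < B" and "\<delta> > 0" for R \<delta>
  proof -
    \<comment> \<open>Half the gap between R and B, so that the mollified parabola keeps its support
      inside (-B, B).\<close>
    define r where "r = (B - R) / 2"
    have r: "r > 0" "R + r < B" using R by (simp_all add: r_def field_simps)
    obtain \<psi> where \<psi>: "smooth \<psi>" "\<And>y. \<bar>y\<bar> > r \<Longrightarrow> \<psi> y = 0" "\<And>t. cmod (fourier \<psi> t) \<le> 1"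
      "(LINT u|lborel. cmod (kern u) * cmod (1 - fourier \<psi> (u / R))) < \<delta>"
      using exists_approximate_bump[OF R(1) r(1) \<open>\<delta> > 0\<close>] by blast
    have zero: "para R \<psi> y = 0" if "\<bar>y\<bar> > R + r" for y
      using para_zero_outside[of r \<psi> R y] \<psi>(2) R(1) that by simp
    let ?I = "\<lambda>T. LINT u|lborel. s (T + u / R) * (kern u * fourier \<psi> (u / R))"
    have "((\<lambda>T. LINT t|lborel. s t * fourier (para R \<psi>) (t - T)) \<longlongrightarrow> 0) at_top"
      by (intro conv[OF smooth_para[OF \<psi>(1)] r(2)]) (use zero in auto)
    moreover have "(LINT t|lborel. s t * fourier (para R \<psi>) (t - T)) = of_real (2 * pi / R) * ?I T" for T
      by (rule convolution_para[OF \<psi>(1) _ R(1)]) (rule \<psi>(2))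
    ultimately have "((\<lambda>T. of_real (2 * pi / R) * ?I T) \<longlongrightarrow> 0) at_top" by simp
    then have "((\<lambda>T. of_real (R / (2 * pi)) * (of_real (2 * pi / R) * ?I T)) \<longlongrightarrow> 0) at_top"
      by (rule tendsto_mult_right_zero)
    then have "(?I \<longlongrightarrow> 0) at_top" using R(1) by simp
    from tendsto_norm[OF this] have "\<forall>\<^sub>F T in at_top. cmod (?I T) < \<delta>"
      using \<open>\<delta> > 0\<close> by (intro order_tendstoD(2)) auto
    then show ?thesis
    proof eventually_elim
      case (elim T)
      have "cmod ((LINT u|lborel. s (T + u / R) * kern u) - ?I T) \<le>
          C * (LINT u|lborel. cmod (kern u) * cmod (1 - fourier \<psi> (u / R)))"
        by (rule kern_fourier_difference[OF \<psi>(1,3)]) (use C in auto)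
      also have "\<dots> \<le> C * \<delta>" using \<psi>(4) C0 by (intro mult_left_mono) auto
      finally have "cmod (LINT u|lborel. s (T + u / R) * kern u) \<le> (C + 1) * \<delta>"
        using elim norm_triangle_ineq2[of "LINT u|lborel. s (T + u / R) * kern u" "?I T"]
        by (simp add: algebra_simps)
      then show ?case
        using kern_approximation[OF lip C R(1), of T]
          norm_triangle_ineq2[of "s T" "LINT u|lborel. s (T + u / R) * kern u"]
        by (simp add: norm_minus_commute)
    qed
  qed
  show ?thesis
  proof (rule ereal_le_epsilon2)
    fix e :: real assume "e > 0"
    \<comment> \<open>R stays strictly below B to leave room for the mollification, so 2 M / B is
      reached only as a limit.\<close>
    have "((\<lambda>R. 2 * M / R) \<longlongrightarrow> 2 * M / B) (at_left B)"
      using \<open>B > 0\<close> by (intro tendsto_intros) auto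
    then have "\<forall>\<^sub>F R in at_left B. 2 * M / R < 2 * M / B + e / 2"
      using \<open>e > 0\<close> by (intro order_tendstoD(2)) auto
    moreover have "\<forall>\<^sub>F R in at_left B. R \<in> {0<..<B}"
      using eventually_at_left_real[OF \<open>B > 0\<close>] .
    ultimately have "\<forall>\<^sub>F R in at_left B. 2 * M / R < 2 * M / B + e / 2 \<and> R \<in> {0<..<B}"
      by (rule eventually_conj)
    then obtain R where R: "2 * M / R < 2 * M / B + e / 2" "0 < R" "R < B"
      using eventually_happens[of _ "at_left B"] by auto
    \<comment> \<open>The total error is \<open>(C + 1) * \<delta>\<close>:
      \<open>C * \<delta>\<close> from replacing the kernel, and \<open>\<delta>\<close> from the
      convolution once it is small.\<close>
    define \<delta> where "\<delta> = e / (2 * (C + 1))"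
    have \<delta>: "\<delta> > 0" "(C + 1) * \<delta> = e / 2" using C0 \<open>e > 0\<close> by (simp_all add: \<delta>_def field_simps)
    have "\<forall>\<^sub>F T in at_top. ereal (cmod (s T)) \<le> ereal (2 * M / B) + ereal e"
      using ev[OF R(2,3) \<delta>(1)]
    proof eventually_elim
      case (elim T)
      then show ?case using R(1) \<delta>(2) by simp
    qed
    then show "Limsup at_top (\<lambda>T. ereal (cmod (s T))) \<le> ereal (2 * M / B) + ereal e"
      by (rule Limsup_bounded)
  qed
qed

section \<open>Boundary values of the Laplace transform\<close>

text \<open>Split \<open>b\<close> at a compact interval outside which it is small. Outside, its
  bound \<open>\<delta>\<close> meets an integrable transform, uniformly in T; inside,
  \<open>b\<close> is integrable and the translated transform tends to 0 boundedly.\<close>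

lemma pseudofunction_density_vanishes:
  assumes \<phi>: "smooth \<phi>" "\<And>y. \<bar>y\<bar> > r \<Longrightarrow> \<phi> y = 0"
    and [measurable]: "b \<in> borel_measurable lebesgue" and loc: "locally_integrable b"
    and lim: "(b \<longlongrightarrow> 0) at_top" "(b \<longlongrightarrow> 0) at_bot"
  shows "((\<lambda>T. LINT t|lebesgue. b t * fourier \<phi> (t - T)) \<longlongrightarrow> 0) at_top"
proof (rule tendstoI)
  fix e :: real assume "e > 0"
  note [measurable] = smooth_measurable[OF \<phi>(1)]
  have [measurable]: "fourier \<phi> \<in> borel_measurable borel" by measurable
  have [measurable]: "(\<lambda>t. fourier \<phi> (t - T)) \<in> borel_measurable lebesgue" for T
    by (rule measurable_completion) measurable
  define K where "K = (LINT t|lborel. cmod (fourier \<phi> t))"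
  have K: "K \<ge> 0" by (simp add: K_def)
  define \<delta> where "\<delta> = e / (2 * (K + 1))"
  have \<delta>: "\<delta> > 0" "\<delta> * K < e / 2" using \<open>e > 0\<close> K by (simp_all add: \<delta>_def field_simps add_pos_nonneg)
  obtain S1 where S1: "\<And>t. t \<ge> S1 \<Longrightarrow> cmod (b t) < \<delta>"
    using order_tendstoD(2)[OF tendsto_norm[OF lim(1)], of \<delta>] \<delta>(1) by (auto simp: eventually_at_top_linorder)
  obtain S2 where S2: "\<And>t. t \<le> S2 \<Longrightarrow> cmod (b t) < \<delta>"
    using order_tendstoD(2)[OF tendsto_norm[OF lim(2)], of \<delta>] \<delta>(1) by (auto simp: eventually_at_bot_linorder)
  define b1 where "b1 t = indicator {S2..S1} t *\<^sub>R b t" for t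
  define b2 where "b2 t = b t - b1 t" for t
  have b1: "integrable lebesgue b1"
    using loc unfolding locally_integrable_def b1_def set_integrable_def by blast
  have [measurable]: "b1 \<in> borel_measurable lebesgue" using b1 by (rule borel_measurable_integrable)
  have [measurable]: "b2 \<in> borel_measurable lebesgue" unfolding b2_def by measurable
  have b2: "cmod (b2 t) \<le> \<delta>" for t
    using S1[of t] S2[of t] \<delta>(1) by (cases "t \<in> {S2..S1}") (auto simp: b2_def b1_def)
  define D where "D = (LINT y|lborel. cmod (\<phi> y))"
  have D: "cmod (fourier \<phi> t) \<le> D" for t
    unfolding D_def by (rule cmod_fourier_le[OF smooth_zero_outside_integrable[OF \<phi>]])
  have shift: "integrable lebesgue (\<lambda>t. cmod (fourier \<phi> (t - T)))"
    "(LINT t|lebesgue. cmod (fourier \<phi> (t - T))) = K" for T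
  proof -
    have F: "integrable lborel (\<lambda>t. cmod (fourier \<phi> t))"
      using fourier_integrable[OF \<phi>] by simp
    have m: "(\<lambda>t. cmod (fourier \<phi> (t - T))) \<in> borel_measurable lborel" by measurable
    show "integrable lebesgue (\<lambda>t. cmod (fourier \<phi> (t - T)))"
      unfolding integrable_completion[OF m] using lborel_integrable_real_affine[OF F, of 1 "- T"] by simp
    show "(LINT t|lebesgue. cmod (fourier \<phi> (t - T))) = K"
      unfolding integral_completion[OF m] K_def
      using lborel_integral_real_affine[of 1 "\<lambda>t. cmod (fourier \<phi> t)" "- T"] by simp
  qed
  have dom1: "AE t in lebesgue. cmod (b1 t * fourier \<phi> (t - T)) \<le> cmod (b1 t) * D" for T
    by (simp add: norm_mult mult_left_mono D)
  have "((\<lambda>T. LINT t|lebesgue. b1 t * fourier \<phi> (t - T)) \<longlongrightarrow> (LINT t::real|lebesgue. 0)) at_top"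
  proof (rule integral_dominated_convergence_at_top[where w = "\<lambda>t. cmod (b1 t) * D"])
    show "integrable lebesgue (\<lambda>t. cmod (b1 t) * D)" using b1 by simp
    show "\<forall>\<^sub>F T in at_top. AE t in lebesgue. cmod (b1 t * fourier \<phi> (t - T)) \<le> cmod (b1 t) * D"
      using dom1 by simp
    show "AE t in lebesgue. ((\<lambda>T. b1 t * fourier \<phi> (t - T)) \<longlongrightarrow> 0) at_top"
      using tendsto_mult_right_zero[OF fourier_tendsto_zero[OF \<phi>]] by simp
  qed measurable
  then have "\<forall>\<^sub>F T in at_top. cmod (LINT t|lebesgue. b1 t * fourier \<phi> (t - T)) < e / 2"
    using \<open>e > 0\<close> by (intro order_tendstoD(2)[OF tendsto_norm]) auto
  then show "\<forall>\<^sub>F T in at_top. dist (LINT t|lebesgue. b t * fourier \<phi> (t - T)) 0 < e"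
  proof eventually_elim
    case (elim T)
    have le: "cmod (b2 t * fourier \<phi> (t - T)) \<le> \<delta> * cmod (fourier \<phi> (t - T))" for t
      unfolding norm_mult by (rule mult_right_mono[OF b2]) simp
    have int2: "integrable lebesgue (\<lambda>t. b2 t * fourier \<phi> (t - T))"
    proof (rule Bochner_Integration.integrable_bound)
      show "integrable lebesgue (\<lambda>t. \<delta> * cmod (fourier \<phi> (t - T)))" using shift(1) by simp
      show "AE t in lebesgue. cmod (b2 t * fourier \<phi> (t - T)) \<le> norm (\<delta> * cmod (fourier \<phi> (t - T)))"
        using le \<delta>(1) by simp
    qed measurable
    have int1: "integrable lebesgue (\<lambda>t. b1 t * fourier \<phi> (t - T))"
    proof (rule Bochner_Integration.integrable_bound)
      show "integrable lebesgue (\<lambda>t. cmod (b1 t) * D)" using b1 by simp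
      show "AE t in lebesgue. cmod (b1 t * fourier \<phi> (t - T)) \<le> norm (cmod (b1 t) * D)"
        using dom1[of T] by eventually_elim (erule order_trans, simp only: real_norm_def abs_ge_self)
    qed measurable
    have "cmod (LINT t|lebesgue. b2 t * fourier \<phi> (t - T)) \<le> (LINT t|lebesgue. \<delta> * cmod (fourier \<phi> (t - T)))"
      by (rule Bochner_Integration.integral_norm_bound_integral[OF int2]) (use shift(1) le in auto)
    also have "\<dots> = \<delta> * K" by (simp add: shift(2))
    finally have 2: "cmod (LINT t|lebesgue. b2 t * fourier \<phi> (t - T)) < e / 2" using \<delta>(2) by simp
    have "(LINT t|lebesgue. b t * fourier \<phi> (t - T)) =
        (LINT t|lebesgue. b1 t * fourier \<phi> (t - T) + b2 t * fourier \<phi> (t - T))"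
      by (simp add: b2_def algebra_simps)
    also have "\<dots> = (LINT t|lebesgue. b1 t * fourier \<phi> (t - T)) + (LINT t|lebesgue. b2 t * fourier \<phi> (t - T))"
      by (rule Bochner_Integration.integral_add[OF int1 int2])
    finally show ?case
      using elim 2 norm_triangle_ineq[of "LINT t|lebesgue. b1 t * fourier \<phi> (t - T)" "LINT t|lebesgue. b2 t * fourier \<phi> (t - T)"]
      by simp
  qed
qed

lemma fourier_multiplication:
  assumes f: "integrable lborel f" and g: "integrable lborel g"
  shows "(LINT y|lborel. fourier f y * g y) = (LINT t|lborel. f t * fourier g t)"
proof -
  have [measurable]: "f \<in> borel_measurable borel" "g \<in> borel_measurable borel"
    using f g borel_measurable_integrable by auto
  have "(LINT y|lborel. fourier f y * g y) =
      (LINT y|lborel. LINT t|lborel. f t * exp (- \<i> * of_real t * of_real y) * g y)"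
    by (simp add: fourier_eq_lborel)
  also have "\<dots> = (LINT t|lborel. LINT y|lborel. f t * exp (- \<i> * of_real t * of_real y) * g y)"
  proof (rule Fubini_dominated(1)[where w = "\<lambda>y t. cmod (f t) * cmod (g y)"
        and W = "\<lambda>y. (LINT t|lborel. cmod (f t)) * cmod (g y)"])
    show "integrable lborel (\<lambda>y. (LINT t|lborel. cmod (f t)) * cmod (g y))" using g by simp
    show "AE y in lborel. integrable lborel (\<lambda>t. cmod (f t) * cmod (g y)) \<and>
        (LINT t|lborel. cmod (f t) * cmod (g y)) \<le> (LINT t|lborel. cmod (f t)) * cmod (g y)"
      using f by simp
  qed (auto simp: norm_mult)
  also have "\<dots> = (LINT t|lborel. f t * fourier g t)"
  proof (intro Bochner_Integration.integral_cong refl)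
    fix t
    have "f t * exp (- \<i> * of_real t * of_real y) * g y = f t * (g y * exp (- \<i> * of_real y * of_real t))" for y
      by (simp add: mult_ac)
    then have "(LINT y|lborel. f t * exp (- \<i> * of_real t * of_real y) * g y) =
        (LINT y|lborel. f t * (g y * exp (- \<i> * of_real y * of_real t)))"
      by (simp only:)
    also have "\<dots> = f t * fourier g t"
      unfolding fourier_eq_lborel[OF \<open>g \<in> borel_measurable borel\<close>] by (rule integral_mult_right_zero)
    finally show "(LINT y|lborel. f t * exp (- \<i> * of_real t * of_real y) * g y) = f t * fourier g t" .
  qed
  finally show ?thesis .
qed

text \<open>\<open>\<alpha>\<close> plays the part of a Borel version of \<open>a\<close> extended
  by zero. Integrals over the half-line can then be written over the whole line.\<close>

locale bounded_density =
  fixes \<alpha> :: "real \<Rightarrow> complex" and M :: real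
  assumes \<alpha>_measurable [measurable]: "\<alpha> \<in> borel_measurable borel"
    and \<alpha>_bound: "cmod (\<alpha> t) \<le> M"
    and \<alpha>_zero: "t \<le> 0 \<Longrightarrow> \<alpha> t = 0"
begin

lemma M_nonneg: "M \<ge> 0"
  using \<alpha>_bound[of 0] norm_ge_zero order_trans by blast

section \<open>Damped primitives and their Fourier transforms\<close>

definition lap :: "complex \<Rightarrow> complex" where
  "lap z = (LINT t|lborel. \<alpha> t * exp (- z * of_real t))"

definition prim :: "real \<Rightarrow> real \<Rightarrow> complex" where
  "prim x t = (LINT u|lborel. indicator {..t} u *\<^sub>R (\<alpha> u * exp (- of_real x * of_real u)))"

text \<open>Its Fourier transform is the difference quotient of the Laplace transform.\<close>
definition tail :: "real \<Rightarrow> real \<Rightarrow> complex" where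
  "tail x t = indicator {0<..} t *\<^sub>R (prim x t - lap (of_real x))"

lemma lap_integrable:
  assumes "Re z > 0"
  shows "integrable lborel (\<lambda>t. \<alpha> t * exp (- z * of_real t))"
proof -
  have "(\<lambda>t. indicator {0<..} t *\<^sub>R (\<alpha> t * exp (- of_real t * z))) = (\<lambda>t. \<alpha> t * exp (- z * of_real t))"
    by (auto simp: fun_eq_iff indicator_def not_less \<alpha>_zero mult.commute)
  then show ?thesis
    using integrable_exp_minus_complex[OF assms \<alpha>_measurable \<alpha>_bound] by simp
qed

lemma integrable_const_indicator_Icc: "integrable lborel (\<lambda>u. c * indicator {a..b::real} u :: real)"
  by (intro integrable_mult_right integrable_real_indicator) (auto simp: emeasure_lborel_Icc_eq)

lemma prim_integrand_le:
  assumes "x \<ge> 0"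
  shows "cmod (indicator {..t} u *\<^sub>R (\<alpha> u * exp (- of_real x * of_real u))) \<le> M * indicator {0..t} u"
proof (cases "u > 0 \<and> u \<le> t")
  case True
  then have "cmod (\<alpha> u) * exp (- (x * u)) \<le> M * 1"
    using assms by (intro mult_mono \<alpha>_bound M_nonneg) auto
  then show ?thesis using True by (simp add: norm_mult norm_exp_eq_Re)
next
  case False
  then show ?thesis using M_nonneg \<alpha>_zero[of u] by (auto simp: indicator_def not_less)
qed

lemma prim_integrable:
  assumes "x \<ge> 0"
  shows "integrable lborel (\<lambda>u. indicator {..t} u *\<^sub>R (\<alpha> u * exp (- of_real x * of_real u)))"
proof (rule Bochner_Integration.integrable_bound)
  show "integrable lborel (\<lambda>u. M * indicator {0..t} u)" by (rule integrable_const_indicator_Icc)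
  show "AE u in lborel. norm (indicator {..t} u *\<^sub>R (\<alpha> u * exp (- of_real x * of_real u))) \<le> norm (M * indicator {0..t} u)"
    by (intro AE_I2 order_trans[OF prim_integrand_le[OF assms]]) simp
qed measurable

lemma prim_nonpos: "t \<le> 0 \<Longrightarrow> prim x t = 0"
proof -
  assume "t \<le> 0"
  then have "indicator {..t} u *\<^sub>R (\<alpha> u * exp (- of_real x * of_real u)) = 0" for u
    by (auto simp: indicator_def \<alpha>_zero)
  then show ?thesis unfolding prim_def by (simp only:) simp
qed

lemma cmod_prim_le:
  assumes "x \<ge> 0"
  shows "cmod (prim x t) \<le> M * \<bar>t\<bar>"
proof -
  have "cmod (prim x t) \<le> (LINT u|lborel. M * indicator {0..t} u)"
    unfolding prim_def
    by (rule Bochner_Integration.integral_norm_bound_integral[OF prim_integrable[OF assms]])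
      (use prim_integrand_le[OF assms] integrable_const_indicator_Icc in auto)
  also have "\<dots> \<le> M * \<bar>t\<bar>" using M_nonneg by (cases "t \<ge> 0") (auto simp: mult_nonneg_nonpos)
  finally show ?thesis .
qed

lemma prim_lipschitz: "M-lipschitz_on UNIV (prim 0)"
proof (rule lipschitz_onI)
  have le: "cmod (prim 0 t - prim 0 t') \<le> M * (t - t')" if "t' \<le> t" for t t'
  proof -
    let ?f = "\<lambda>t u. indicator {..t} u *\<^sub>R (\<alpha> u * exp (- of_real 0 * of_real u))"
    have "prim 0 t - prim 0 t' = (LINT u|lborel. ?f t u - ?f t' u)"
      unfolding prim_def by (rule Bochner_Integration.integral_diff[symmetric]; rule prim_integrable) simp_all
    also have "cmod \<dots> \<le> (LINT u|lborel. M * indicator {t'..t} u)"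
    proof (rule Bochner_Integration.integral_norm_bound_integral)
      show "integrable lborel (\<lambda>u. ?f t u - ?f t' u)"
        by (rule Bochner_Integration.integrable_diff; rule prim_integrable) simp_all
      show "cmod (?f t u - ?f t' u) \<le> M * indicator {t'..t} u" for u
        using \<alpha>_bound[of u] M_nonneg that by (auto simp: indicator_def)
    qed (rule integrable_const_indicator_Icc)
    also have "\<dots> = M * (t - t')" using that by simp
    finally show ?thesis .
  qed
  show "dist (prim 0 t) (prim 0 t') \<le> M * dist t t'" for t t'
    using le[of t t'] le[of t' t] by (cases "t' \<le> t") (simp_all add: dist_norm norm_minus_commute)
qed (rule M_nonneg)

lemma prim_measurable [measurable]: "prim x \<in> borel_measurable borel"
proof -
  have "(\<lambda>t. LINT u|lborel. (if u \<le> t then 1 else 0) *\<^sub>R (\<alpha> u * exp (- of_real x * of_real u))) \<in> borel_measurable borel"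
    by measurable
  then show ?thesis
    unfolding prim_def[abs_def] indicator_def by simp
qed

lemma tail_measurable [measurable]: "tail x \<in> borel_measurable borel"
  unfolding tail_def[abs_def] by measurable

text \<open>Although it grows with t, this bound is uniform as x tends to 0 while \<open>lap\<close>
  stays bounded; exponential decay of \<open>tail\<close>, available for each fixed x > 0, would not
  be.\<close>

lemma cmod_tail_le:
  assumes "x \<ge> 0"
  shows "cmod (tail x t) \<le> M * \<bar>t\<bar> + cmod (lap (of_real x))"
proof (cases "t > 0")
  case True
  then show ?thesis
    using norm_triangle_ineq4[of "prim x t" "lap (of_real x)"] cmod_prim_le[OF assms, of t]
    by (simp add: tail_def)
next
  case False
  then have "tail x t = 0" by (simp add: tail_def)
  moreover have "0 \<le> M * \<bar>t\<bar> + cmod (lap (of_real x))"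
    by (intro add_nonneg_nonneg mult_nonneg_nonneg M_nonneg) auto
  ultimately show ?thesis by simp
qed

text \<open>On the real axis \<open>lap\<close> is the integral over all u, so subtracting it from
  \<open>prim\<close> leaves minus the remainder beyond t. This form shows the decay in t.\<close>

lemma tail_eq:
  assumes "x > 0"
  shows "tail x t = - (LINT u|lborel. (indicator {0<..} t * indicator {t<..} u) *\<^sub>R (\<alpha> u * exp (- of_real x * of_real u)))"
proof (cases "t > 0")
  case True
  let ?g = "\<lambda>u. \<alpha> u * exp (- of_real x * of_real u)"
  have "prim x t - lap (of_real x) = (LINT u|lborel. indicator {..t} u *\<^sub>R ?g u - ?g u)"
    unfolding prim_def lap_def using assms
    by (intro Bochner_Integration.integral_diff[symmetric] prim_integrable lap_integrable) auto
  also have "\<dots> = (LINT u|lborel. - (indicator {t<..} u *\<^sub>R ?g u))"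
    by (intro Bochner_Integration.integral_cong) (auto simp: indicator_def)
  finally show ?thesis using True by (simp add: tail_def)
qed (simp add: tail_def)

text \<open>Insert the remainder form of \<open>tail\<close> and integrate over t in (0, u) first:
  the exponential integrates to \<open>(1 - exp(-i u y)) / (i y)\<close>, and the outer integral
  splits into two Laplace transforms.\<close>

lemma fourier_tail:
  assumes x: "x > 0"
  shows "integrable lborel (tail x)"
    and "y \<noteq> 0 \<Longrightarrow> fourier (tail x) y = (lap (Complex x y) - lap (of_real x)) / (\<i> * of_real y)"
proof -
  let ?g = "\<lambda>u. \<alpha> u * exp (- of_real x * of_real u)"
  let ?e = "\<lambda>y t. exp (- \<i> * of_real t * of_real y)"
  let ?f = "\<lambda>y t u. (indicator {0<..} t * indicator {t<..} u) *\<^sub>R (?g u * ?e y t)"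
  \<comment> \<open>For t < u, \<open>exp (-x u)\<close> is at most
    \<open>exp (-x t/2) exp (-x u/2)\<close>. Giving half of the decay to each variable makes the
    majorant a product.\<close>
  let ?h = "\<lambda>t. indicator {0<..} t *\<^sub>R exp (- (t * (x / 2)))"
  have h: "integrable lborel ?h" by (rule integral_exp_minus(1)) (use x in simp)
  note F = Fubini_dominated[of "?f y" "\<lambda>t u. ?h t * (M * ?h u)" "\<lambda>t. ?h t * (M * (LINT u|lborel. ?h u))" for y]
  have prem: "(\<lambda>(t, u). ?f y t u) \<in> borel_measurable (lborel \<Otimes>\<^sub>M lborel)"
    "AE t in lborel. integrable lborel (\<lambda>u. ?h t * (M * ?h u)) \<and>
      (LINT u|lborel. ?h t * (M * ?h u)) \<le> ?h t * (M * (LINT u|lborel. ?h u))"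
    "\<And>t u. cmod (?f y t u) \<le> ?h t * (M * ?h u)"
    "integrable lborel (\<lambda>t. ?h t * (M * (LINT u|lborel. ?h u)))" for y
  proof -
    \<comment> \<open>The domain 0 < t < u couples both variables; written as a predicate it is
      within reach of \<open>measurable\<close>.\<close>
    have "(\<lambda>(t, u). (if 0 < t \<and> t < u then 1 else 0) *\<^sub>R (?g u * ?e y t)) \<in> borel_measurable (lborel \<Otimes>\<^sub>M lborel)"
      by measurable
    also have "(\<lambda>(t, u). (if 0 < t \<and> t < u then 1 else 0) *\<^sub>R (?g u * ?e y t)) = (\<lambda>(t, u). ?f y t u)"
      by (auto simp: indicator_def fun_eq_iff)
    finally show "(\<lambda>(t, u). ?f y t u) \<in> borel_measurable (lborel \<Otimes>\<^sub>M lborel)" .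
    show "AE t in lborel. integrable lborel (\<lambda>u. ?h t * (M * ?h u)) \<and>
      (LINT u|lborel. ?h t * (M * ?h u)) \<le> ?h t * (M * (LINT u|lborel. ?h u))"
      using h by simp
    show "integrable lborel (\<lambda>t. ?h t * (M * (LINT u|lborel. ?h u)))" using h by simp
    show "cmod (?f y t u) \<le> ?h t * (M * ?h u)" for t u
    proof (cases "0 < t \<and> t < u")
      case True
      have "cmod (?f y t u) = cmod (\<alpha> u) * exp (- (x * u))"
        using True by (simp add: norm_mult norm_exp_eq_Re)
      also have "\<dots> \<le> M * exp (- (t * (x / 2)) + - (u * (x / 2)))"
      proof (intro mult_mono \<alpha>_bound M_nonneg)
        have "t * (x / 2) \<le> u * (x / 2)" using True x by (intro mult_right_mono) auto
        then show "exp (- (x * u)) \<le> exp (- (t * (x / 2)) + - (u * (x / 2)))"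
          by (simp add: mult.commute)
      qed simp
      finally show ?thesis unfolding exp_add using True by (simp add: mult_ac)
    next
      case False
      then have "?f y t u = 0" by (auto simp: indicator_def)
      moreover have "0 \<le> ?h t * (M * ?h u)" using M_nonneg by simp
      ultimately show ?thesis by (simp only: norm_zero)
    qed
  qed
  have tail: "(LINT u|lborel. ?f y t u) = - (tail x t * ?e y t)" for y t
  proof -
    have "(LINT u|lborel. ?f y t u) = (LINT u|lborel. (indicator {0<..} t * indicator {t<..} u) *\<^sub>R ?g u * ?e y t)"
      by simp
    also have "\<dots> = (LINT u|lborel. (indicator {0<..} t * indicator {t<..} u) *\<^sub>R ?g u) * ?e y t"
      by (rule integral_mult_left_zero)
    finally show ?thesis by (simp add: tail_eq[OF x])
  qed
  \<comment> \<open>At y = 0 the exponential is 1, so Fubini yields the integrability of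
    \<open>tail x\<close> itself.\<close>
  have "integrable lborel (\<lambda>t. - (tail x t * ?e 0 t))"
    using F(2)[OF prem, of 0] unfolding tail .
  then show int: "integrable lborel (tail x)" by simp
  assume y: "y \<noteq> 0"
  have inner: "(LINT t|lborel. ?f y t u) = ?g u * ((1 - ?e y u) / (\<i> * of_real y))" for u
  proof (cases "u > 0")
    case True
    let ?E = "\<lambda>t. - ?e y t / (\<i> * of_real y)"
    have "((\<lambda>z. - exp (- \<i> * z * of_real y) / (\<i> * of_real y)) has_field_derivative ?e y t) (at (of_real t))" for t
      using y by (auto intro!: derivative_eq_intros)
    then have "(?E has_vector_derivative ?e y t) (at t within A)" for t A
      using has_vector_derivative_at_within has_vector_derivative_real_field by blast
    then have FTC: "(LINT t|lborel. indicator {0..u} t *\<^sub>R ?e y t) = ?E u - ?E 0"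
      using True by (intro integral_FTC_Icc) (auto intro!: continuous_intros)
    have "(LINT t|lborel. ?f y t u) = (LINT t|lborel. ?g u * (indicator {0..u} t *\<^sub>R ?e y t))"
    proof (rule integral_cong_AE)
      show "AE t in lborel. ?f y t u = ?g u * (indicator {0..u} t *\<^sub>R ?e y t)"
        using AE_lborel_singleton[of 0] AE_lborel_singleton[of u]
        by eventually_elim (auto simp: indicator_def)
      have eq: "?f y t u = (indicator {0<..} t * indicator {..<u} t) *\<^sub>R (?g u * ?e y t)" for t
        by (simp add: indicator_def)
      show "(\<lambda>t. ?f y t u) \<in> borel_measurable lborel" unfolding eq by measurable
    qed measurable
    also have "\<dots> = ?g u * (LINT t|lborel. indicator {0..u} t *\<^sub>R ?e y t)"
      by (rule integral_mult_right_zero)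
    finally show ?thesis unfolding FTC by (simp add: diff_divide_distrib)
  next
    case False
    then show ?thesis by (simp add: \<alpha>_zero)
  qed
  have "fourier (tail x) y = - (LINT t|lborel. LINT u|lborel. ?f y t u)"
    unfolding tail by (simp add: fourier_eq_lborel)
  also have "\<dots> = - (LINT u|lborel. ?g u * ((1 - ?e y u) / (\<i> * of_real y)))"
    unfolding F(1)[OF prem] inner ..
  also have "(\<lambda>u. ?g u * ((1 - ?e y u) / (\<i> * of_real y))) =
      (\<lambda>u. (?g u - \<alpha> u * exp (- Complex x y * of_real u)) / (\<i> * of_real y))"
  proof
    fix u
    have "exp (- of_real x * of_real u) * ?e y u = exp (- Complex x y * of_real u)"
      unfolding exp_add[symmetric] Complex_eq by (simp add: algebra_simps)
    then show "?g u * ((1 - ?e y u) / (\<i> * of_real y)) =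
      (?g u - \<alpha> u * exp (- Complex x y * of_real u)) / (\<i> * of_real y)"
      by (simp add: right_diff_distrib mult.assoc)
  qed
  also have "- (LINT u|lborel. (?g u - \<alpha> u * exp (- Complex x y * of_real u)) / (\<i> * of_real y)) =
      - ((lap (of_real x) - lap (Complex x y)) / (\<i> * of_real y))"
    unfolding integral_divide_zero lap_def
    by (subst Bochner_Integration.integral_diff) (use lap_integrable[of "of_real x"] lap_integrable[of "Complex x y"] x in auto)
  finally show "fourier (tail x) y = (lap (Complex x y) - lap (of_real x)) / (\<i> * of_real y)"
    by (simp add: minus_divide_left)
qed

lemma tail_tendsto:
  assumes X: "X \<longlonglongrightarrow> 0" "\<And>n. X n > 0" and lap: "(\<lambda>n. lap (of_real (X n))) \<longlonglongrightarrow> f0"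
  shows "(\<lambda>n. tail (X n) t) \<longlonglongrightarrow> indicator {0<..} t *\<^sub>R (prim 0 t - f0)"
proof -
  have "(\<lambda>n. prim (X n) t) \<longlonglongrightarrow> prim 0 t"
    unfolding prim_def
  proof (rule integral_dominated_convergence[where w = "\<lambda>u. M * indicator {0..t} u"])
    show "AE u in lborel. norm (indicator {..t} u *\<^sub>R (\<alpha> u * exp (- of_real (X n) * of_real u))) \<le> M * indicator {0..t} u" for n
      using prim_integrand_le[of "X n"] X(2)[of n] by simp
    show "AE u in lborel. (\<lambda>n. indicator {..t} u *\<^sub>R (\<alpha> u * exp (- of_real (X n) * of_real u)))
        \<longlonglongrightarrow> indicator {..t} u *\<^sub>R (\<alpha> u * exp (- of_real 0 * of_real u))"
      by (intro AE_I2 tendsto_intros X(1))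
    show "integrable lborel (\<lambda>u. M * indicator {0..t} u)" by (rule integrable_const_indicator_Icc)
  qed simp_all
  then show ?thesis
    unfolding tail_def by (intro tendsto_intros lap)
qed

text \<open>Dominated convergence: \<open>lap\<close> converges along \<open>X\<close> and is
  therefore bounded there, and the linear growth of \<open>tail\<close> is absorbed by the weighted
  integrability of \<open>fourier \<phi>\<close>.\<close>

lemma boundary_value:
  assumes \<phi>: "smooth \<phi>" "\<And>y. \<bar>y\<bar> > r \<Longrightarrow> \<phi> y = 0"
    and X: "X \<longlonglongrightarrow> 0" "\<And>n. X n > 0" and lap: "(\<lambda>n. lap (of_real (X n))) \<longlonglongrightarrow> f0"
  shows "(\<lambda>n. LINT t|lborel. tail (X n) t * fourier \<phi> t) \<longlonglongrightarrow>
    (LINT t|lborel. (indicator {0<..} t *\<^sub>R (prim 0 t - f0)) * fourier \<phi> t)"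
proof -
  note [measurable] = smooth_measurable[OF \<phi>(1)]
  obtain C where C: "\<And>n. cmod (lap (of_real (X n))) \<le> C"
    using convergent_imp_Bseq[OF convergentI[OF lap]] by (auto simp: Bseq_def)
  have C0: "C \<ge> 0" using C[of 0] norm_ge_zero order_trans by blast
  show ?thesis
  proof (rule integral_dominated_convergence[where w = "\<lambda>t. (M + C) * ((1 + \<bar>t\<bar>) * cmod (fourier \<phi> t))"])
    show "integrable lborel (\<lambda>t. (M + C) * ((1 + \<bar>t\<bar>) * cmod (fourier \<phi> t)))"
      using weighted_fourier_integrable[OF \<phi>] by simp
    show "AE t in lborel. (\<lambda>n. tail (X n) t * fourier \<phi> t) \<longlonglongrightarrow>
        (indicator {0<..} t *\<^sub>R (prim 0 t - f0)) * fourier \<phi> t"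
      by (intro AE_I2 tendsto_mult tendsto_const tail_tendsto[OF X lap])
    have "cmod (tail (X n) t * fourier \<phi> t) \<le> (M + C) * ((1 + \<bar>t\<bar>) * cmod (fourier \<phi> t))" for n t
    proof -
      have "cmod (tail (X n) t) \<le> M * \<bar>t\<bar> + C"
        using cmod_tail_le[of "X n" t] X(2)[of n] C[of n] by simp
      also have "\<dots> \<le> (M + C) * (1 + \<bar>t\<bar>)"
        using M_nonneg C0 by (simp add: algebra_simps)
      finally show ?thesis
        unfolding norm_mult mult.assoc[symmetric] by (rule mult_right_mono) simp
    qed
    then show "AE t in lborel. norm (tail (X n) t * fourier \<phi> t) \<le> (M + C) * ((1 + \<bar>t\<bar>) * cmod (fourier \<phi> t))" for n
      by simp
  qed measurable
qed

text \<open>For y \<noteq> 0 the quotient is the transform of \<open>tail x\<close>, and the value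
  \<open>deriv f\<close> at y = 0 affects only a null set. The transform is then moved onto
  \<open>\<phi>\<close>.\<close>

lemma vertical_quotient_pairing:
  assumes f: "\<And>z. Re z > 0 \<Longrightarrow> f z = lap z" and x: "x > 0"
    and \<phi>: "smooth \<phi>" "\<And>y. \<bar>y\<bar> > r \<Longrightarrow> \<phi> y = 0"
  shows "(LINT y|lebesgue. vertical_quotient f (Complex x y) * \<phi> y) = (LINT t|lborel. tail x t * fourier \<phi> t)"
proof -
  note [measurable] = smooth_measurable[OF \<phi>(1)]
  define q where "q y = (if y = 0 then deriv f (Complex x 0) else fourier (tail x) y)" for y
  have q: "vertical_quotient f (Complex x y) = q y" for y
    using f[of "Complex x y"] f[of "of_real x"] x fourier_tail(2)[OF x, of y]
    by (simp add: vertical_quotient_def q_def)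
  have [measurable]: "q \<in> borel_measurable borel"
    unfolding q_def[abs_def] by measurable
  have "(LINT y|lebesgue. vertical_quotient f (Complex x y) * \<phi> y) = (LINT y|lborel. q y * \<phi> y)"
    unfolding q by (rule integral_completion) measurable
  also have "\<dots> = (LINT y|lborel. fourier (tail x) y * \<phi> y)"
  proof (rule integral_cong_AE)
    show "AE y in lborel. q y * \<phi> y = fourier (tail x) y * \<phi> y"
      by (rule AE_mp[OF AE_lborel_singleton[of 0]]) (simp add: q_def)
  qed measurable
  also have "\<dots> = (LINT t|lborel. tail x t * fourier \<phi> t)"
    by (rule fourier_multiplication[OF fourier_tail(1)[OF x] smooth_zero_outside_integrable[OF \<phi>]])
  finally show ?thesis .
qed

lemma convolution_tendsto_zero:
  assumes f: "\<And>z. Re z > 0 \<Longrightarrow> f z = lap z"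
    and lim: "((\<lambda>x. f (complex_of_real x)) \<longlongrightarrow> f0) (at_right 0)"
    and conv: "converges_to_pseudofunction_on (vertical_quotient f) {-B<..<B}"
    and \<phi>: "smooth \<phi>" "\<And>y. \<bar>y\<bar> > r \<Longrightarrow> \<phi> y = 0" and r: "r < B"
  shows "((\<lambda>T. LINT t|lborel. (prim 0 t - f0) * fourier \<phi> (t - T)) \<longlongrightarrow> 0) at_top"
proof -
  note [measurable] = smooth_measurable[OF \<phi>(1)]
  define \<sigma> where "\<sigma> t = indicator {0<..} t *\<^sub>R (prim 0 t - f0)" for t
  have [measurable]: "\<sigma> \<in> borel_measurable borel" unfolding \<sigma>_def[abs_def] by measurable
  obtain Q F where Q: "\<And>\<phi>. test_function_on {-B<..<B} \<phi> \<Longrightarrow>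
      ((\<lambda>x. LINT y|lebesgue. vertical_quotient f (Complex x y) * \<phi> y) \<longlongrightarrow> Q \<phi>) (at_right 0)"
    and F: "pseudofunction F" and QF: "\<And>\<phi>. test_function_on {-B<..<B} \<phi> \<Longrightarrow> Q \<phi> = F \<phi>"
    using conv unfolding converges_to_pseudofunction_on_def by blast
  obtain b where b: "b \<in> borel_measurable lebesgue" "locally_integrable b" "(b \<longlongrightarrow> 0) at_top" "(b \<longlongrightarrow> 0) at_bot"
    and Fb: "\<And>\<phi>. schwartz \<phi> \<Longrightarrow> F \<phi> = (LINT t|lebesgue. b t * fourier \<phi> t)"
    using F unfolding pseudofunction_def by blast
  define X where "X n = inverse (real (Suc n))" for n
  have X: "X \<longlonglongrightarrow> 0" "\<And>n. X n > 0"
    unfolding X_def[abs_def] using LIMSEQ_inverse_real_of_nat by simp_all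
  have "X n \<noteq> 0" for n using X(2)[of n] by simp
  with X have X_right: "filterlim X (at_right 0) sequentially"
    by (simp add: filterlim_at)
  have lap: "(\<lambda>n. lap (of_real (X n))) \<longlonglongrightarrow> f0"
    using filterlim_compose[OF lim X_right] f X(2) by simp
  have pairing: "(LINT t|lborel. \<sigma> t * fourier \<theta> t) = (LINT t|lebesgue. b t * fourier \<theta> t)"
    if \<theta>: "smooth \<theta>" "\<And>y. \<bar>y\<bar> > r \<Longrightarrow> \<theta> y = 0" for \<theta>
  proof -
    have test: "test_function_on {-B<..<B} \<theta>"
      by (rule test_function_onI[OF \<theta>]) (use r in auto)
    have "(\<lambda>n. LINT t|lborel. tail (X n) t * fourier \<theta> t) \<longlonglongrightarrow> (LINT t|lborel. \<sigma> t * fourier \<theta> t)"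
      unfolding \<sigma>_def by (rule boundary_value[OF \<theta> X lap])
    moreover have "(\<lambda>n. LINT t|lborel. tail (X n) t * fourier \<theta> t) \<longlonglongrightarrow> Q \<theta>"
      using filterlim_compose[OF Q[OF test] X_right] vertical_quotient_pairing[OF f X(2) \<theta>] by simp
    ultimately have "(LINT t|lborel. \<sigma> t * fourier \<theta> t) = Q \<theta>"
      by (rule LIMSEQ_unique)
    then show ?thesis
      using QF[OF test] Fb[OF smooth_zero_outside_imp_schwartz[OF \<theta>]] by simp
  qed
  have shifted: "(LINT t|lborel. \<sigma> t * fourier \<phi> (t - T)) = (LINT t|lebesgue. b t * fourier \<phi> (t - T))" for T
  proof -
    have "smooth (\<lambda>y. \<phi> y * exp (\<i> * of_real T * of_real y))"
      by (rule smooth_mult[OF \<phi>(1) smooth_exp])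
    from pairing[OF this] show ?thesis
      using \<phi>(2) by (simp add: fourier_modulate)
  qed
  have lim\<sigma>: "((\<lambda>T. LINT t|lborel. \<sigma> t * fourier \<phi> (t - T)) \<longlongrightarrow> 0) at_top"
    unfolding shifted by (rule pseudofunction_density_vanishes[OF \<phi> b])
  \<comment> \<open>\<open>\<sigma>\<close> is zero for t <= 0, whereas the Lipschitz function
    \<open>prim 0 t - f0\<close> equals \<open>- f0\<close> there. The discrepancy is
    \<open>- f0\<close> times the integral of \<open>fourier \<phi>\<close> over v <= -T, which
    vanishes in the limit.\<close>
  have neg: "((\<lambda>T. LINT v|lborel. - f0 * (indicator {..- T} v *\<^sub>R fourier \<phi> v)) \<longlongrightarrow> (LINT v::real|lborel. 0)) at_top"
  proof (rule integral_dominated_convergence_at_top[where w = "\<lambda>v. cmod f0 * cmod (fourier \<phi> v)"])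
    show "integrable lborel (\<lambda>v. cmod f0 * cmod (fourier \<phi> v))"
      using fourier_integrable[OF \<phi>] by simp
    show "\<forall>\<^sub>F T in at_top. AE v in lborel. norm (- f0 * (indicator {..- T} v *\<^sub>R fourier \<phi> v)) \<le> cmod f0 * cmod (fourier \<phi> v)"
      by (intro always_eventually allI AE_I2) (auto simp: indicator_def norm_mult)
    show "AE v in lborel. ((\<lambda>T. - f0 * (indicator {..- T} v *\<^sub>R fourier \<phi> v)) \<longlongrightarrow> 0) at_top"
    proof (rule AE_I2)
      fix v :: real
      have "\<forall>\<^sub>F T in at_top. 0 = - f0 * (indicator {..- T} v *\<^sub>R fourier \<phi> v)"
        using eventually_gt_at_top[of "- v"] by eventually_elim (auto simp: indicator_def)
      then show "((\<lambda>T. - f0 * (indicator {..- T} v *\<^sub>R fourier \<phi> v)) \<longlongrightarrow> 0) at_top"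
        by (rule Lim_transform_eventually[OF tendsto_const])
    qed
  qed measurable
  have "(LINT t|lborel. (prim 0 t - f0) * fourier \<phi> (t - T)) =
      (LINT t|lborel. \<sigma> t * fourier \<phi> (t - T)) + (LINT v|lborel. - f0 * (indicator {..- T} v *\<^sub>R fourier \<phi> v))" for T
  proof -
    let ?N = "\<lambda>v. - f0 * (indicator {..- T} v *\<^sub>R fourier \<phi> v)"
    have N: "integrable lborel ?N"
    proof (rule Bochner_Integration.integrable_bound)
      show "integrable lborel (\<lambda>v. cmod f0 * cmod (fourier \<phi> v))"
        using fourier_integrable[OF \<phi>] by simp
      show "AE v in lborel. norm (?N v) \<le> norm (cmod f0 * cmod (fourier \<phi> v))"
        by (intro AE_I2) (auto simp: indicator_def norm_mult)
    qed measurable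
    have N': "integrable lborel (\<lambda>t. ?N (t - T))" "(LINT t|lborel. ?N (t - T)) = (LINT v|lborel. ?N v)"
      using lborel_integrable_real_affine[OF N, of 1 "- T"] lborel_integral_real_affine[of 1 ?N "- T"] by simp_all
    have \<sigma>: "integrable lborel (\<lambda>t. \<sigma> t * fourier \<phi> (t - T))"
    proof (rule Bochner_Integration.integrable_bound)
      \<comment> \<open>The estimate |t| <= |T| + |t - T| turns linear growth in t into the weight 1
        + |t - T|, with a constant depending on T.\<close>
      let ?w = "\<lambda>v. (M * \<bar>T\<bar> + M + cmod f0) * ((1 + \<bar>v\<bar>) * cmod (fourier \<phi> v))"
      have "integrable lborel ?w" using weighted_fourier_integrable[OF \<phi>] by simp
      from lborel_integrable_real_affine[OF this, of 1 "- T"]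
      show "integrable lborel (\<lambda>t. ?w (t - T))" by simp
      have le: "cmod (\<sigma> t * fourier \<phi> (t - T)) \<le> ?w (t - T)" for t
      proof -
        have "cmod (\<sigma> t) \<le> cmod (prim 0 t - f0)" by (simp add: \<sigma>_def indicator_def)
        also have "\<dots> \<le> M * \<bar>t\<bar> + cmod f0"
          using norm_triangle_ineq4[of "prim 0 t" f0] cmod_prim_le[of 0 t] by simp
        also have "M * \<bar>t\<bar> \<le> M * (\<bar>T\<bar> + \<bar>t - T\<bar>)" using M_nonneg by (intro mult_left_mono) auto
        also have "M * (\<bar>T\<bar> + \<bar>t - T\<bar>) + cmod f0 \<le> (M * \<bar>T\<bar> + M + cmod f0) * (1 + \<bar>t - T\<bar>)"
          using M_nonneg by (simp add: algebra_simps)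
        finally show ?thesis
          unfolding norm_mult mult.assoc[symmetric] by - (rule mult_right_mono, simp_all)
      qed
      show "AE t in lborel. norm (\<sigma> t * fourier \<phi> (t - T)) \<le> norm (?w (t - T))"
        by (intro AE_I2 order_trans[OF le]) (simp only: real_norm_def abs_ge_self)
    qed measurable
    have "(prim 0 t - f0) * fourier \<phi> (t - T) = \<sigma> t * fourier \<phi> (t - T) + ?N (t - T)" for t
      by (cases "t > 0") (auto simp: \<sigma>_def prim_nonpos)
    then have "(LINT t|lborel. (prim 0 t - f0) * fourier \<phi> (t - T)) =
        (LINT t|lborel. \<sigma> t * fourier \<phi> (t - T) + ?N (t - T))" by simp
    also have "\<dots> = (LINT t|lborel. \<sigma> t * fourier \<phi> (t - T)) + (LINT t|lborel. ?N (t - T))"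
      by (rule Bochner_Integration.integral_add[OF \<sigma> N'(1)])
    finally show ?thesis unfolding N'(2) .
  qed
  then show ?thesis
    using tendsto_add[OF lim\<sigma> neg] by simp
qed

lemma limsup_bound:
  assumes "B > 0" and f: "\<And>z. Re z > 0 \<Longrightarrow> f z = lap z"
    and lim: "((\<lambda>x. f (complex_of_real x)) \<longlongrightarrow> f0) (at_right 0)"
    and conv: "converges_to_pseudofunction_on (vertical_quotient f) {-B<..<B}"
  shows "Limsup at_top (\<lambda>T. ereal (cmod (prim 0 T - f0))) \<le> ereal (2 * M / B)"
proof (rule lipschitz_tauberian[OF \<open>B > 0\<close>, where c = "- f0"])
  show "M-lipschitz_on UNIV (\<lambda>t. prim 0 t - f0)"
    using prim_lipschitz by (auto simp: lipschitz_on_def dist_norm)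
  show "prim 0 t - f0 = - f0" if "t \<le> 0" for t using prim_nonpos[OF that] by simp
  show "((\<lambda>T. LINT t|lborel. (prim 0 t - f0) * fourier \<phi> (t - T)) \<longlongrightarrow> 0) at_top"
    if "smooth \<phi>" "r < B" "\<And>y. \<bar>y\<bar> > r \<Longrightarrow> \<phi> y = 0" for \<phi> r
    by (rule convolution_tendsto_zero[OF f lim conv that(1,3,2)])
qed

end

section \<open>Passage from Lebesgue measurable to Borel densities\<close>

lemma exists_bounded_density:
  fixes a :: "real \<Rightarrow> complex"
  assumes meas: "set_borel_measurable lebesgue {0..} a" and bdd: "bounded (a ` {0..})"
    and M: "M = (SUP t\<in>{0<..}. cmod (a t))"
  obtains \<alpha> where "bounded_density \<alpha> M" "AE t in lebesgue. indicator {0..} t *\<^sub>R a t = \<alpha> t"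
proof -
  define g where "g t = indicator {0..} t *\<^sub>R a t" for t
  have g: "g \<in> borel_measurable lebesgue"
    using meas unfolding set_borel_measurable_def g_def[abs_def] .
  have aM: "cmod (a t) \<le> M" if "t > 0" for t
  proof -
    obtain K where "\<And>t. t \<ge> 0 \<Longrightarrow> cmod (a t) \<le> K" using bdd unfolding bounded_iff by auto
    then have "bdd_above ((\<lambda>t. cmod (a t)) ` {0<..})" by (intro bdd_aboveI[of _ K]) auto
    then show ?thesis unfolding M using that by (intro cSUP_upper) auto
  qed
  have "(\<lambda>t. Re (g t)) \<in> borel_measurable lebesgue" "(\<lambda>t. Im (g t)) \<in> borel_measurable lebesgue"
    using g by (auto intro: borel_measurable_Re borel_measurable_Im measurable_compose)
  then obtain u v where [measurable]: "u \<in> borel_measurable lborel" "v \<in> borel_measurable lborel"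
    and uv: "AE t in lborel. Re (g t) = u t" "AE t in lborel. Im (g t) = v t"
    using completion_ex_borel_measurable_real by metis
  \<comment> \<open>The Borel versions agree with \<open>a\<close> only almost everywhere. Cutting
    off where the modulus exceeds \<open>M\<close> makes the bound hold everywhere and alters a null
    set only; the point t = 0, which the supremum does not see, is sent to 0 as well.\<close>
  define \<alpha> where "\<alpha> t = (if t > 0 \<and> cmod (of_real (u t) + \<i> * of_real (v t)) \<le> M
    then of_real (u t) + \<i> * of_real (v t) else 0)" for t
  have M0: "M \<ge> 0" using aM[of 1] norm_ge_zero[of "a 1"] by linarith
  have "AE t in lborel. g t = \<alpha> t"
    using uv AE_lborel_singleton[of 0]
  proof eventually_elim
    case (elim t)
    then have eq: "of_real (u t) + \<i> * of_real (v t) = g t" by (simp add: complex_eq_iff)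
    show ?case unfolding \<alpha>_def eq using aM[of t] elim(3) by (auto simp: g_def indicator_def)
  qed
  then have "AE t in lebesgue. g t = \<alpha> t" by (rule AE_completion)
  moreover have "bounded_density \<alpha> M"
  proof
    have "\<alpha> \<in> borel_measurable lborel" unfolding \<alpha>_def[abs_def] by measurable
    then show "\<alpha> \<in> borel_measurable borel" by simp
  qed (use M0 in \<open>auto simp: \<alpha>_def\<close>)
  ultimately show ?thesis using that unfolding g_def by blast
qed

theorem theorem1p3:
  fixes a :: "real \<Rightarrow> complex" and B M :: real and f :: "complex \<Rightarrow> complex" and f0 :: complex
  assumes "B > 0"
    and "set_borel_measurable lebesgue {0..} a"
    and "bounded (a ` {0..})"
    and "M = (SUP t\<in>{0<..}. cmod (a t))"
    and "f = laplace a"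
    and "((\<lambda>x. f (complex_of_real x)) \<longlongrightarrow> f0) (at_right 0)"
    and "converges_to_pseudofunction_on (vertical_quotient f) {-B<..<B}"
  shows "Limsup at_top (\<lambda>T. ereal (cmod ((LINT t:{0..T}|lebesgue. a t) - f0))) \<le> ereal (2 * M / B)"
proof -
  obtain \<alpha> where \<alpha>: "bounded_density \<alpha> M" and ae: "AE t in lebesgue. indicator {0..} t *\<^sub>R a t = \<alpha> t"
    using exists_bounded_density[OF assms(2-4)] by blast
  interpret bounded_density \<alpha> M by (rule \<alpha>)
  have meas: "(\<lambda>t. indicator {0..} t *\<^sub>R a t) \<in> borel_measurable lebesgue"
    using assms(2) unfolding set_borel_measurable_def .
  \<comment> \<open>Both integrals of \<open>a\<close> in the statement pair its zero extension with
    a Borel function \<open>g\<close>: an exponential for the Laplace transform, the indicator of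
    \<open>{..T}\<close> for the partial integral.\<close>
  have transfer: "(LINT t|lebesgue. (indicator {0..} t *\<^sub>R a t) * g t) = (LINT t|lborel. \<alpha> t * g t)"
    if [measurable]: "g \<in> borel_measurable borel" for g
  proof -
    have [measurable]: "g \<in> borel_measurable lebesgue" "\<alpha> \<in> borel_measurable lebesgue"
      by (auto intro: measurable_completion)
    have "(LINT t|lebesgue. (indicator {0..} t *\<^sub>R a t) * g t) = (LINT t|lebesgue. \<alpha> t * g t)"
    proof (rule integral_cong_AE)
      show "AE t in lebesgue. (indicator {0..} t *\<^sub>R a t) * g t = \<alpha> t * g t"
        using ae by eventually_elim simp
    qed (use meas in measurable)
    also have "\<dots> = (LINT t|lborel. \<alpha> t * g t)" by (rule integral_completion) measurable
    finally show ?thesis .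
  qed
  have "f z = lap z" for z
    using transfer[of "\<lambda>t. exp (- z * of_real t)"]
    by (simp add: assms(5) laplace_def lap_def set_lebesgue_integral_def)
  then have "Limsup at_top (\<lambda>T. ereal (cmod (prim 0 T - f0))) \<le> ereal (2 * M / B)"
    by (intro limsup_bound[OF assms(1) _ assms(6,7)])
  moreover have "(LINT t:{0..T}|lebesgue. a t) = prim 0 T" for T
  proof -
    have "(LINT t:{0..T}|lebesgue. a t) = (LINT t|lebesgue. (indicator {0..} t *\<^sub>R a t) * of_real (indicator {..T} t))"
      unfolding set_lebesgue_integral_def
      by (intro Bochner_Integration.integral_cong) (auto simp: indicator_def)
    also have "\<dots> = (LINT t|lborel. \<alpha> t * of_real (indicator {..T} t))"
      by (rule transfer) measurable
    also have "\<dots> = prim 0 T"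
      unfolding prim_def by (simp add: scaleR_conv_of_real mult.commute)
    finally show ?thesis .
  qed
  ultimately show ?thesis by simp
qed

end
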